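(* Let $u^1,\dots,u^n:\mathbb{R}^m\to\mathbb{R}$ be smooth functions such that their graph $M=\{(x,u^1(x),\dots,u^n(x)) : x\in\mathbb{R}^m\}$ is a spacelike translating soliton in $\mathbb{R}^{m+n}_n$. Let $g_{ij}=\delta_{ij}-\sum_{\alpha=1}^n \frac{\partial u^\alpha}{\partial x_i}\frac{\partial u^\alpha}{\partial x_j}$ be the induced metric. Suppose there exists a number $\epsilon>0$ such that $$(g_{ij}(x))>\frac{\epsilon}{|x|}I\quad\text{as } |x|\to\infty,$$ i.e. there is $R_0>0$ such that the matrix $(g_{ij}(x))-\frac{\epsilon}{|x|}I$ is positive definite for all $|x|>R_0$. Then $u^1,\dots,u^n$ are linear functions on $\mathbb{R}^m$ (polynomials of degree at most one), and $M$ is an affine $m$-plane in $\mathbb{R}^{m+n}_n$.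
   Context: $\mathbb{R}^{m+n}_n$ is the linear space $\mathbb{R}^{m+n}$ with the indefinite metric $\langle\cdot,\cdot\rangle = \sum_{i=1}^m (dx^i)^2-\sum_{\alpha=m+1}^{m+n}(dx^\alpha)^2$. A graph over $\mathbb{R}^m$ is spacelike if the induced metric $(g_{ij})$ is positive definite everywhere. With $\overline\nabla$ the flat connection and $(\cdot)^\perp$ the orthogonal projection (with respect to $\langle\cdot,\cdot\rangle$) onto the normal bundle, the second fundamental form is $B_{YW}=(\overline\nabla_Y W)^\perp$ and the mean curvature vector $H$ is its trace with respect to the induced metric. $M$ is a spacelike translating soliton (translator) if it is spacelike and there is a non-zero constant vector $T\in\mathbb{R}^{m+n}$ such that $H=T^\perp$ on $M$. For the graph, writing $T=(a^1,\dots,a^m,b^1,\dots,b^n)$, this is equivalent to $\sum_{i,j} g^{ij}u^\alpha_{ij}=-\sum_i a^iu^\alpha_i+b^\alpha$ for $\alpha=1,\dots,n$, where subscripts denote partial derivatives and $(g^{ij})$ is the inverse of $(g_{ij})$. $|x|$ is the Euclidean norm on $\mathbb{R}^m$ and $I$ the identity matrix. *)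

theory Defs
  imports "HOL-Analysis.Analysis"
begin

primrec times_cont_differentiable ::
    "nat \<Rightarrow> ('a::real_normed_vector \<Rightarrow> 'b::real_normed_vector) \<Rightarrow> bool" where
  "times_cont_differentiable 0 f \<longleftrightarrow> continuous_on UNIV f"
| "times_cont_differentiable (Suc k) f \<longleftrightarrow>
     (\<forall>x. f differentiable (at x)) \<and>
     (\<forall>v. times_cont_differentiable k (\<lambda>x. frechet_derivative f (at x) v))"

definition smooth :: "('a::real_normed_vector \<Rightarrow> 'b::real_normed_vector) \<Rightarrow> bool" where
  "smooth f \<longleftrightarrow> (\<forall>k. times_cont_differentiable k f)"

definition positive_definite :: "real^'m^'m \<Rightarrow> bool" where
  "positive_definite A \<longleftrightarrow> transpose A = A \<and> (\<forall>v. v \<noteq> 0 \<longrightarrow> 0 < v \<bullet> (A *v v))"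

text \<open>
  The pseudo-Euclidean space of dimension \<open>m + n\<close> and index \<open>n\<close> is represented by the
  product type \<open>(real^'m) \<times> (real^'n)\<close>, whose second factor is the negative definite one.
\<close>

definition pseudo_inner ::
    "(real^'m) \<times> (real^'n) \<Rightarrow> (real^'m) \<times> (real^'n) \<Rightarrow> real" where
  "pseudo_inner v w = fst v \<bullet> fst w - snd v \<bullet> snd w"

text \<open>
  Submanifolds are given by a global parametrization \<open>F\<close>; tangent vector fields are given by
  their coordinate representations, that is, \<open>W\<close> stands for the field \<open>x \<mapsto> dF\<^sub>x (W x)\<close>.
\<close>

definition tangent_space ::
    "(real^'m \<Rightarrow> (real^'m) \<times> (real^'n)) \<Rightarrow> real^'m \<Rightarrow> ((real^'m) \<times> (real^'n)) set" where
  "tangent_space F x = range (frechet_derivative F (at x))"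

definition normal_space ::
    "(real^'m \<Rightarrow> (real^'m) \<times> (real^'n)) \<Rightarrow> real^'m \<Rightarrow> ((real^'m) \<times> (real^'n)) set" where
  "normal_space F x = {v. \<forall>w \<in> tangent_space F x. pseudo_inner v w = 0}"

definition induced_metric ::
    "(real^'m \<Rightarrow> (real^'m) \<times> (real^'n)) \<Rightarrow> real^'m \<Rightarrow> real^'m^'m" where
  "induced_metric F x = (\<chi> i j. pseudo_inner (frechet_derivative F (at x) (axis i 1))
                                            (frechet_derivative F (at x) (axis j 1)))"

definition spacelike :: "(real^'m \<Rightarrow> (real^'m) \<times> (real^'n)) \<Rightarrow> bool" where
  "spacelike F \<longleftrightarrow> (\<forall>x. positive_definite (induced_metric F x))"

text \<open>
  The description below determines the projection only if the tangent space is nondegenerate,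
  which holds where the induced metric is positive definite; see \<open>normal_proj_ex1\<close>.
\<close>

definition normal_proj ::
    "(real^'m \<Rightarrow> (real^'m) \<times> (real^'n)) \<Rightarrow> real^'m \<Rightarrow>
     (real^'m) \<times> (real^'n) \<Rightarrow> (real^'m) \<times> (real^'n)" where
  "normal_proj F x v = (THE w. w \<in> normal_space F x \<and> v - w \<in> tangent_space F x)"

definition second_fundamental_form ::
    "(real^'m \<Rightarrow> (real^'m) \<times> (real^'n)) \<Rightarrow> (real^'m \<Rightarrow> real^'m) \<Rightarrow> (real^'m \<Rightarrow> real^'m) \<Rightarrow>
     real^'m \<Rightarrow> (real^'m) \<times> (real^'n)" where
  "second_fundamental_form F Y W x =
     normal_proj F x
       (frechet_derivative (\<lambda>y. frechet_derivative F (at y) (W y)) (at x) (Y x))"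

definition mean_curvature_vector ::
    "(real^'m \<Rightarrow> (real^'m) \<times> (real^'n)) \<Rightarrow> real^'m \<Rightarrow> (real^'m) \<times> (real^'n)" where
  "mean_curvature_vector F x =
     (\<Sum>i\<in>UNIV. \<Sum>j\<in>UNIV. matrix_inv (induced_metric F x) $ i $ j *\<^sub>R
        second_fundamental_form F (\<lambda>_. axis i 1) (\<lambda>_. axis j 1) x)"

definition spacelike_translating_soliton ::
    "(real^'m \<Rightarrow> (real^'m) \<times> (real^'n)) \<Rightarrow> bool" where
  "spacelike_translating_soliton F \<longleftrightarrow>
     spacelike F \<and> (\<exists>T. T \<noteq> 0 \<and> (\<forall>x. mean_curvature_vector F x = normal_proj F x T))"

definition graph_map :: "('n \<Rightarrow> real^'m \<Rightarrow> real) \<Rightarrow> real^'m \<Rightarrow> (real^'m) \<times> (real^'n)" where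
  "graph_map u x = (x, \<chi> \<alpha>. u \<alpha> x)"

lemma normal_proj_ex1:
  fixes F :: "real^'m \<Rightarrow> (real^'m) \<times> (real^'n)"
  assumes "F differentiable (at x)" and pd: "positive_definite (induced_metric F x)"
  shows "\<exists>!w. w \<in> normal_space F x \<and> v - w \<in> tangent_space F x"
proof -
  define D where "D = frechet_derivative F (at x)"
  define G where "G = induced_metric F x"
  have "linear D"
    unfolding D_def by (rule linear_frechet_derivative[OF assms(1)])
  then interpret linear D .
  have D_expand: "D a = (\<Sum>i\<in>UNIV. a $ i *\<^sub>R D (axis i 1))" for a
  proof -
    have "a = (\<Sum>i\<in>UNIV. a $ i *\<^sub>R axis i 1)"
      using basis_expansion[of a] by (simp add: scalar_mult_eq_scaleR)
    then have "D a = D (\<Sum>i\<in>UNIV. a $ i *\<^sub>R axis i 1)" by simp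
    then show ?thesis by (simp add: sum scale)
  qed
  have bil: "pseudo_inner (p + q) r = pseudo_inner p r + pseudo_inner q r"
    "pseudo_inner (p - q) r = pseudo_inner p r - pseudo_inner q r"
    "pseudo_inner (c *\<^sub>R p) r = c * pseudo_inner p r"
    "pseudo_inner p (c *\<^sub>R r) = c * pseudo_inner p r"
    "pseudo_inner p r = pseudo_inner r p"
    for p q r :: "(real^'m) \<times> (real^'n)" and c
    by (auto simp: pseudo_inner_def algebra_simps inner_commute)
  have sumL: "pseudo_inner (\<Sum>i\<in>UNIV. f i) r = (\<Sum>i\<in>UNIV. pseudo_inner (f i) r)"
    for f :: "'m \<Rightarrow> (real^'m) \<times> (real^'n)" and r
    by (simp add: pseudo_inner_def fst_sum snd_sum inner_sum_left sum_subtractf)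
  have sumR: "pseudo_inner r (\<Sum>i\<in>UNIV. f i) = (\<Sum>i\<in>UNIV. pseudo_inner r (f i))"
    for f :: "'m \<Rightarrow> (real^'m) \<times> (real^'n)" and r
    by (simp add: pseudo_inner_def fst_sum snd_sum inner_sum_right sum_subtractf)
  have Gij: "G $ i $ j = pseudo_inner (D (axis i 1)) (D (axis j 1))" for i j
    by (simp add: G_def induced_metric_def D_def)
  have Gi: "(G *v a) $ i = pseudo_inner (D a) (D (axis i 1))" for a i
    unfolding matrix_vector_mult_def Gij
    by (subst D_expand[of a]) (simp add: sumL bil(3) bil(5)[of "D (axis i 1)"] mult.commute)
  have Gq: "pseudo_inner (D a) (D b) = b \<bullet> (G *v a)" for a b
    by (subst D_expand[of b]) (simp add: sumR bil(4) inner_vec_def Gi)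
  have pos: "a \<noteq> 0 \<Longrightarrow> 0 < a \<bullet> (G *v a)" for a
    using pd by (simp add: positive_definite_def G_def)
  have "inj ((*v) G)"
  proof (rule injI)
    fix a b assume "G *v a = G *v b"
    then have "(a - b) \<bullet> (G *v (a - b)) = 0" by (simp add: matrix_vector_mult_diff_distrib)
    then show "a = b" using pos[of "a - b"] by force
  qed
  then have "surj ((*v) G)"
    by (intro linear_injective_imp_surjective[OF matrix_vector_mul_linear]) auto
  then obtain a where a: "(\<chi> i. pseudo_inner v (D (axis i 1))) = G *v a" by (rule surjE)
  have nor: "w \<in> normal_space F x \<longleftrightarrow> (\<forall>b. pseudo_inner w (D b) = 0)" for w
    by (auto simp: normal_space_def tangent_space_def D_def)
  have tan: "w \<in> tangent_space F x \<longleftrightarrow> (\<exists>b. w = D b)" for w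
    by (auto simp: tangent_space_def D_def)
  show ?thesis
  proof
    have *: "pseudo_inner (v - D a) (D (axis i 1)) = 0" for i
      using a by (simp add: bil(2) vec_eq_iff Gi)
    have "pseudo_inner (v - D a) (D b) = 0" for b
      by (subst D_expand[of b]) (simp add: sumR bil(4) *)
    then show "v - D a \<in> normal_space F x \<and> v - (v - D a) \<in> tangent_space F x"
      unfolding nor tan by auto
  next
    fix w assume w: "w \<in> normal_space F x \<and> v - w \<in> tangent_space F x"
    then obtain b where b: "v - w = D b" unfolding tan by auto
    have "pseudo_inner (v - D a) (D (axis i 1)) = 0" for i
      using a by (simp add: bil(2) vec_eq_iff Gi)
    then have va: "pseudo_inner (v - D a) (D c) = 0" for c
      by (subst D_expand[of c]) (simp add: sumR bil(4))
    have wv: "w = v - D b" using b by (simp add: algebra_simps)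
    have "pseudo_inner (v - D b) (D c) = 0" for c using w unfolding nor wv by blast
    then have "pseudo_inner (D (a - b)) (D c) = 0" for c
      using va[of c] by (simp add: bil(2) diff)
    then have "(a - b) \<bullet> (G *v (a - b)) = 0" by (simp add: Gq)
    then have "a = b" using pos[of "a - b"] by force
    then show "w = v - D a" using wv by simp
  qed
qed

lemma induced_metric_graph_map:
  fixes u :: "'n::finite \<Rightarrow> real^'m \<Rightarrow> real"
  assumes "\<And>\<alpha>. u \<alpha> differentiable (at x)"
  shows "induced_metric (graph_map u) x $ i $ j =
    (if i = j then 1 else 0) -
    (\<Sum>\<alpha>\<in>UNIV. frechet_derivative (u \<alpha>) (at x) (axis i 1) *
                frechet_derivative (u \<alpha>) (at x) (axis j 1))"
proof -
  have "(u \<alpha> has_derivative frechet_derivative (u \<alpha>) (at x)) (at x)" for \<alpha>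
    using assms frechet_derivative_works by blast
  then have "((\<lambda>y. \<chi> \<alpha>. u \<alpha> y) has_derivative
      (\<lambda>h. \<chi> \<alpha>. frechet_derivative (u \<alpha>) (at x) h)) (at x)"
    by (subst has_derivative_componentwise_within) (auto simp: Basis_vec_def inner_axis)
  then have "(graph_map u has_derivative
      (\<lambda>h. (h, \<chi> \<alpha>. frechet_derivative (u \<alpha>) (at x) h))) (at x)"
    unfolding graph_map_def by (intro has_derivative_Pair has_derivative_ident)
  then have "frechet_derivative (graph_map u) (at x) =
      (\<lambda>h. (h, \<chi> \<alpha>. frechet_derivative (u \<alpha>) (at x) h))"
    by (rule frechet_derivative_at[symmetric])
  then show ?thesis
    by (simp add: induced_metric_def pseudo_inner_def inner_axis_axis) (simp add: inner_vec_def)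
qed

end

theory Submission
  imports Defs
begin

text \<open>
  Let \<open>X(x) = (x, u x)\<close> be the position vector of the graph and \<open>a\<close> the horizontal part of \<open>T\<close>.  The
  translator equation says \<open>L X = T\<close> for the operator
  \<open>L f = \<Sum>\<^sub>k\<^sub>l g\<^sup>k\<^sup>l \<partial>\<^sub>k \<partial>\<^sub>l f + \<partial>\<^sub>a f\<close>, which is the Laplacian of the induced metric plus the derivative
  along the tangential part of \<open>T\<close>.  So \<open>L\<close> does not depend on the coordinates on the graph, and
  the equation survives every linear isometry of the ambient space.  The theorem is a Liouville
  theorem: the second fundamental form \<open>B\<close> vanishes.

  The size of \<open>B\<close> is measured by the largest value \<open>\<sigma>\<close> of \<open>|\<langle>B(v,v), \<nu>\<rangle>|\<close> over unit tangent vectors \<open>v\<close> and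
  unit normal vectors \<open>\<nu>\<close>.  It satisfies \<open>L \<sigma> \<ge> \<sigma>\<^sup>3\<close> in the sense of barriers, a Simons type inequality
  without lower order terms: the normal bundle is negative definite, which gives the curvature terms
  the good sign, and the drift drops out by differentiating the equation.  To see it, fix a point, a
  maximising pair \<open>(v, \<nu>)\<close>, and a linear isometry taking the tangent space there to the horizontal
  space.  In the new coordinates the heights \<open>w\<close> have vanishing first derivatives at the point, so
  the metric is Euclidean to first order.  With \<open>\<omega>\<close> the component of \<open>w\<close> along \<open>\<nu>\<close>,
  \<open>h = D\<^sup>2 \<omega>\<close> and \<open>M\<^sub>i\<^sub>j = D\<^sub>v D\<^sub>i w \<bullet> D\<^sub>v D\<^sub>j w\<close>, differentiating the equation twice along \<open>v\<close> gives
  \<open>L (D\<^sub>v D\<^sub>v \<omega>) = - 2 tr(M h)\<close>, while the normalising factors for \<open>v\<close> and \<open>\<nu>\<close> contribute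
  \<open>2 \<sigma> tr M + \<sigma> |h|\<^sup>2\<close>.  Maximality says \<open>h \<le> \<sigma>\<close> as a quadratic form, and \<open>M\<close> is positive semidefinite, so
  \<open>tr(M h) \<le> \<sigma> tr M\<close> and only \<open>\<sigma> |h|\<^sup>2 \<ge> \<sigma>\<^sup>3\<close> remains.

  Now maximise \<open>\<eta> \<sigma>\<close> with the cutoff \<open>\<eta> = R\<^sup>2 - |x|\<^sup>2\<close> on the ball of radius \<open>R\<close>.  At the maximum the
  inequality gives \<open>(\<eta> \<sigma>)\<^sup>2 \<le> 2 |\<nabla>\<eta>|\<^sup>2 - \<eta> L \<eta>\<close>.  The hypothesis on the metric bounds the inverse metric by
  a multiple of \<open>R\<close> on this ball, so the right-hand side is \<open>O(R\<^sup>3)\<close>.  At a fixed point \<open>\<eta>\<close> grows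
  like \<open>R\<^sup>2\<close>, hence \<open>\<sigma> = O(R\<^sup>-\<^sup>1\<^sup>/\<^sup>2)\<close> there, and \<open>R \<rightarrow> \<infinity>\<close> gives \<open>\<sigma> = 0\<close>.

  The change of coordinates is not carried out as a reparametrisation.  The new coordinate
  functions have an invertible Jacobian matrix everywhere, and their dual vector fields are commuting
  derivations of the algebra of smooth functions on the original domain (\<open>D_commute\<close>); the whole
  computation takes place in this algebra.  The inequality at the maximum is
  \<open>weighted_maximum_inequality\<close>, the isometry comes from \<open>boost_to_horizontal\<close>, the translation
  into the geometry of the graph is \<open>maximum_estimate\<close>, and the limit is taken in
  \<open>hessian_vanishes\<close>.
\<close>

section \<open>Smooth functions and their directional derivatives\<close>

abbreviation dird :: "'a::real_normed_vector \<Rightarrow> ('a \<Rightarrow> real) \<Rightarrow> 'a \<Rightarrow> real" where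
  "dird v f x \<equiv> frechet_derivative f (at x) v"

lemma times_cont_differentiable_SucD:
  "times_cont_differentiable (Suc k) f \<Longrightarrow> times_cont_differentiable k f"
proof (induction k arbitrary: f)
  case 0
  then show ?case
    by (auto intro!: continuous_at_imp_continuous_on differentiable_imp_continuous_within)
next
  case (Suc k)
  then show ?case by (metis times_cont_differentiable.simps(2))
qed

text \<open>Smoothness is a coinductive notion: this equivalence is what makes the operations below
  compatible with repeated differentiation.\<close>

lemma smooth_iff:
  "smooth f \<longleftrightarrow> (\<forall>x. f differentiable (at x)) \<and> (\<forall>v. smooth (\<lambda>x. frechet_derivative f (at x) v))"
proof
  assume s: "smooth f"
  then have "times_cont_differentiable (Suc k) f" for k by (simp only: smooth_def)
  then show "(\<forall>x. f differentiable (at x)) \<and> (\<forall>v. smooth (\<lambda>x. frechet_derivative f (at x) v))"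
    by (auto simp: smooth_def)
next
  assume r: "(\<forall>x. f differentiable (at x)) \<and> (\<forall>v. smooth (\<lambda>x. frechet_derivative f (at x) v))"
  then have "times_cont_differentiable (Suc k) f" for k by (simp add: smooth_def)
  then show "smooth f" unfolding smooth_def using times_cont_differentiable_SucD by blast
qed

lemma smooth_differentiable: "smooth f \<Longrightarrow> f differentiable (at x)"
  by (simp add: smooth_iff[of f])

lemma smooth_dird: "smooth f \<Longrightarrow> smooth (\<lambda>x. frechet_derivative f (at x) v)"
  by (simp add: smooth_iff[of f])

lemma smooth_has_derivative: "smooth f \<Longrightarrow> (f has_derivative frechet_derivative f (at x)) (at x)"
  using smooth_differentiable frechet_derivative_works by blast

lemma smooth_continuous_on: "smooth f \<Longrightarrow> continuous_on S f"
  by (meson continuous_at_imp_continuous_on differentiable_imp_continuous_within smooth_differentiable)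

lemma continuous_on_smooth_fst:
  fixes f :: "real^'m \<Rightarrow> real"
  shows "smooth f \<Longrightarrow> continuous_on S (\<lambda>z. f (fst z))"
  by (rule continuous_on_compose2[OF smooth_continuous_on[of f UNIV]]) (auto intro: continuous_intros)

lemma dird_linear: "smooth f \<Longrightarrow> linear (\<lambda>v. frechet_derivative f (at x) v)"
  using linear_frechet_derivative smooth_differentiable by blast

lemma dird_add:
  assumes "f differentiable (at x)" "g differentiable (at x)"
  shows "frechet_derivative (\<lambda>x. f x + g x) (at x) v
       = frechet_derivative f (at x) v + frechet_derivative g (at x) v"
  by (rule fun_cong[OF frechet_derivative_at[symmetric]])
     (intro has_derivative_add; simp add: assms frechet_derivative_works[symmetric])

lemma dird_mult:
  fixes f g :: "'a::real_normed_vector \<Rightarrow> real"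
  assumes "f differentiable (at x)" "g differentiable (at x)"
  shows "dird v (\<lambda>x. f x * g x) x = dird v f x * g x + f x * dird v g x"
proof -
  have "((\<lambda>x. f x * g x) has_derivative (\<lambda>v. f x * dird v g x + dird v f x * g x)) (at x)"
    by (intro has_derivative_mult; simp add: assms frechet_derivative_works[symmetric])
  then show ?thesis by (metis frechet_derivative_at add.commute)
qed

lemma dird_inverse:
  fixes f :: "'a::real_normed_vector \<Rightarrow> real"
  assumes "f differentiable (at x)" "f x \<noteq> 0"
  shows "dird v (\<lambda>x. inverse (f x)) x = - (dird v f x * (inverse (f x) * inverse (f x)))"
proof -
  have "((\<lambda>x. inverse (f x)) has_derivative (\<lambda>v. - (inverse (f x) * dird v f x * inverse (f x)))) (at x)"
    using assms by (intro Deriv.has_derivative_inverse; simp add: frechet_derivative_works[symmetric])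
  then have "frechet_derivative (\<lambda>x. inverse (f x)) (at x)
      = (\<lambda>v. - (inverse (f x) * dird v f x * inverse (f x)))"
    by (rule frechet_derivative_at[symmetric])
  then show ?thesis by (simp add: mult_ac)
qed

lemma times_cont_differentiable_const: "times_cont_differentiable k (\<lambda>x. c)"
  by (induction k arbitrary: c) auto

lemma smooth_const [simp]: "smooth (\<lambda>x. c)"
  by (simp add: smooth_def times_cont_differentiable_const)

lemma bounded_linear_smooth:
  assumes "bounded_linear f" shows "smooth f"
proof -
  have "frechet_derivative f (at x) = f" for x
    using assms by (metis bounded_linear_imp_has_derivative frechet_derivative_at)
  then show ?thesis
    using assms by (simp add: smooth_iff[of f] bounded_linear_imp_differentiable)
qed

lemma times_cont_differentiable_add:
  "times_cont_differentiable k f \<Longrightarrow> times_cont_differentiable k g \<Longrightarrow>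
   times_cont_differentiable k (\<lambda>x. f x + g x)"
  by (induction k arbitrary: f g) (auto intro: continuous_on_add simp: dird_add)

lemma times_cont_differentiable_mult:
  fixes f g :: "'a::real_normed_vector \<Rightarrow> real"
  shows "times_cont_differentiable k f \<Longrightarrow> times_cont_differentiable k g \<Longrightarrow>
   times_cont_differentiable k (\<lambda>x. f x * g x)"
proof (induction k arbitrary: f g)
  case (Suc k)
  have "times_cont_differentiable k f" "times_cont_differentiable k g"
    using Suc.prems times_cont_differentiable_SucD by auto
  with Suc show ?case by (auto simp: dird_mult intro!: times_cont_differentiable_add differentiable_mult)
qed (auto intro: continuous_on_mult)

lemma times_cont_differentiable_inverse:
  fixes f :: "'a::real_normed_vector \<Rightarrow> real"
  assumes nz: "\<And>x. f x \<noteq> 0"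
  shows "times_cont_differentiable k f \<Longrightarrow> times_cont_differentiable k (\<lambda>x. inverse (f x))"
proof (induction k)
  case (Suc k)
  have k: "times_cont_differentiable k (\<lambda>x. inverse (f x))"
    using Suc times_cont_differentiable_SucD by blast
  have df: "f differentiable (at x)" for x using Suc.prems by simp
  have "times_cont_differentiable k
      (\<lambda>x. (-1) * (dird v f x * (inverse (f x) * inverse (f x))))" for v
    using Suc.prems k by (intro times_cont_differentiable_mult times_cont_differentiable_const) auto
  then show ?case using df nz by (simp add: dird_inverse differentiable_inverse)
qed (auto intro: continuous_on_inverse simp: nz)

lemma smooth_add: "smooth f \<Longrightarrow> smooth g \<Longrightarrow> smooth (\<lambda>x. f x + g x)"
  by (simp add: smooth_def times_cont_differentiable_add)

lemma smooth_mult: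
  fixes f g :: "'a::real_normed_vector \<Rightarrow> real"
  shows "smooth f \<Longrightarrow> smooth g \<Longrightarrow> smooth (\<lambda>x. f x * g x)"
  by (simp add: smooth_def times_cont_differentiable_mult)

lemma smooth_inverse:
  fixes f :: "'a::real_normed_vector \<Rightarrow> real"
  shows "smooth f \<Longrightarrow> (\<And>x. f x \<noteq> 0) \<Longrightarrow> smooth (\<lambda>x. inverse (f x))"
  by (simp add: smooth_def times_cont_differentiable_inverse)

lemma smooth_cmult:
  fixes f :: "'a::real_normed_vector \<Rightarrow> real"
  shows "smooth f \<Longrightarrow> smooth (\<lambda>x. c * f x)"
  by (intro smooth_mult smooth_const)

lemma smooth_diff:
  fixes f g :: "'a::real_normed_vector \<Rightarrow> real"
  assumes "smooth f" "smooth g" shows "smooth (\<lambda>x. f x - g x)"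
  using smooth_add[OF assms(1) smooth_cmult[OF assms(2), of "-1"]] by simp

lemma smooth_sum:
  fixes f :: "'i \<Rightarrow> 'a::real_normed_vector \<Rightarrow> real"
  shows "(\<And>i. i \<in> I \<Longrightarrow> smooth (f i)) \<Longrightarrow> smooth (\<lambda>x. \<Sum>i\<in>I. f i x)"
  by (induction I rule: infinite_finite_induct) (auto intro: smooth_add)

lemma smooth_prod:
  fixes f :: "'i \<Rightarrow> 'a::real_normed_vector \<Rightarrow> real"
  shows "(\<And>i. i \<in> I \<Longrightarrow> smooth (f i)) \<Longrightarrow> smooth (\<lambda>x. \<Prod>i\<in>I. f i x)"
  by (induction I rule: infinite_finite_induct) (auto intro: smooth_mult)

lemma smooth_component [simp]: "smooth (\<lambda>x::real^'m. x $ k)"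
  by (intro bounded_linear_smooth bounded_linear_vec_nth)

lemmas smooth_intros = smooth_const smooth_component smooth_add smooth_diff smooth_mult smooth_sum
  smooth_cmult smooth_dird

lemma linear_expand_axis:
  fixes f :: "real^'m \<Rightarrow> 'b::real_vector"
  assumes "linear f"
  shows "f v = (\<Sum>k\<in>UNIV. v $ k *\<^sub>R f (axis k 1))"
proof -
  interpret linear f by (rule assms)
  have "f v = f (\<Sum>k\<in>UNIV. v $ k *\<^sub>R axis k 1)"
    using basis_expansion[of v] by (simp add: scalar_mult_eq_scaleR)
  then show ?thesis by (simp add: sum scale)
qed

lemma det_nonzero_if_kernel_trivial:
  fixes A :: "real^'m^'m"
  assumes "\<And>v. A *v v = 0 \<Longrightarrow> v = 0"
  shows "det A \<noteq> 0"
proof -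
  have "inj ((*v) A)"
    by (subst linear_injective_0[OF matrix_vector_mul_linear]) (use assms in blast)
  then show ?thesis
    using det_nz_iff_inj[OF matrix_vector_mul_linear, of A] by (simp add: matrix_of_matrix_vector_mul)
qed

lemma matrix_inv_cofactors:
  fixes A :: "real^'m^'m"
  assumes "det A \<noteq> 0"
  shows "A ** matrix_inv A = mat 1" "matrix_inv A ** A = mat 1"
    "matrix_inv A $ i $ j = det (\<chi> k l. if l = i then axis j 1 $ k else A $ k $ l) * inverse (det A)"
proof -
  have inv: "invertible A" using assms invertible_det_nz by blast
  then have *: "A ** matrix_inv A = mat 1 \<and> matrix_inv A ** A = mat 1"
    unfolding invertible_def matrix_inv_def by (rule someI_ex)
  then show "A ** matrix_inv A = mat 1" "matrix_inv A ** A = mat 1" by auto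
  have "A *v (matrix_inv A *v axis j 1) = axis j 1"
    using * by (simp add: matrix_vector_mul_assoc)
  then have "matrix_inv A *v axis j 1
      = (\<chi> k. det (\<chi> k' l. if l = k then axis j 1 $ k' else A $ k' $ l) / det A)"
    using cramer[OF assms] by blast
  moreover have "(matrix_inv A *v axis j 1) $ i = matrix_inv A $ i $ j"
    by (simp add: matrix_vector_mul_component inner_axis row_def inner_vec_def axis_def if_distrib
        cong: if_cong)
  ultimately show "matrix_inv A $ i $ j
      = det (\<chi> k l. if l = i then axis j 1 $ k else A $ k $ l) * inverse (det A)"
    by (simp add: divide_inverse)
qed

lemma smooth_det:
  fixes A :: "'a::real_normed_vector \<Rightarrow> real^'m^'m"
  assumes "\<And>i j. smooth (\<lambda>x. A x $ i $ j)"
  shows "smooth (\<lambda>x. det (A x))"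
  unfolding det_def using assms by (intro smooth_sum smooth_mult smooth_prod smooth_const)

text \<open>By Cramer's rule the entries of the inverse are quotients of polynomials in the entries.\<close>

lemma smooth_matrix_inv:
  fixes A :: "'a::real_normed_vector \<Rightarrow> real^'m^'m"
  assumes sm: "\<And>i j. smooth (\<lambda>x. A x $ i $ j)" and nz: "\<And>x. det (A x) \<noteq> 0"
  shows "smooth (\<lambda>x. matrix_inv (A x) $ i $ j)"
proof -
  have "smooth (\<lambda>x. (\<chi> k l. if l = i then axis j 1 $ k else A x $ k $ l) $ k $ l)" for k l
    using sm by (cases "l = i") auto
  then show ?thesis
    unfolding matrix_inv_cofactors(3)[OF nz] using nz
    by (intro smooth_mult smooth_inverse smooth_det sm) auto
qed

lemma smooth_line_deriv:
  fixes f :: "'a::real_normed_vector \<Rightarrow> real"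
  assumes "smooth f"
  shows "((\<lambda>t. f (x + t *\<^sub>R v)) has_real_derivative dird v f (x + t *\<^sub>R v)) (at t)"
proof -
  have "((\<lambda>t. x + t *\<^sub>R v) has_derivative (\<lambda>h. h *\<^sub>R v)) (at t)"
    by (auto intro!: derivative_eq_intros)
  from has_derivative_compose[OF this smooth_has_derivative[OF assms]]
  have "((\<lambda>t. f (x + t *\<^sub>R v)) has_derivative (\<lambda>h. dird (h *\<^sub>R v) f (x + t *\<^sub>R v))) (at t)" by simp
  moreover have "(\<lambda>h. dird (h *\<^sub>R v) f (x + t *\<^sub>R v)) = (*) (dird v f (x + t *\<^sub>R v))"
    using linear_scale[OF dird_linear[OF assms]] by (simp add: fun_eq_iff mult.commute)
  ultimately show ?thesis unfolding has_field_derivative_def by (simp only:)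
qed

text \<open>Two applications of the mean value theorem, first in direction \<open>v\<close> and then in direction
  \<open>w\<close>.  The left-hand side is symmetric in \<open>v\<close> and \<open>w\<close>, which is the source of the symmetry of
  second derivatives.\<close>

lemma second_difference_mvt:
  fixes f :: "'a::real_normed_vector \<Rightarrow> real"
  assumes f: "smooth f" and h: "0 < h"
  shows "\<exists>s t. 0 < s \<and> s < h \<and> 0 < t \<and> t < h \<and>
    f (x + h *\<^sub>R v + h *\<^sub>R w) - f (x + h *\<^sub>R v) - f (x + h *\<^sub>R w) + f x
      = h * h * dird w (dird v f) (x + s *\<^sub>R v + t *\<^sub>R w)"
proof -
  have "((\<lambda>s. f ((x + h *\<^sub>R w) + s *\<^sub>R v) - f (x + s *\<^sub>R v)) has_real_derivative
      (dird v f ((x + h *\<^sub>R w) + s *\<^sub>R v) - dird v f (x + s *\<^sub>R v))) (at s)" for s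
    by (intro DERIV_diff smooth_line_deriv f)
  from MVT2[OF h this] obtain s where s: "0 < s" "s < h" and
    1: "(f ((x + h *\<^sub>R w) + h *\<^sub>R v) - f (x + h *\<^sub>R v)) - (f (x + h *\<^sub>R w) - f x)
      = h * (dird v f ((x + h *\<^sub>R w) + s *\<^sub>R v) - dird v f (x + s *\<^sub>R v))" by auto
  from MVT2[OF h smooth_line_deriv[OF smooth_dird[OF f, of v], of "x + s *\<^sub>R v" w]] obtain t where
    t: "0 < t" "t < h" and 2: "dird v f (x + s *\<^sub>R v + h *\<^sub>R w) - dird v f (x + s *\<^sub>R v)
      = h * dird w (dird v f) (x + s *\<^sub>R v + t *\<^sub>R w)" by auto
  show ?thesis
    by (rule exI[of _ s], rule exI[of _ t]) (use s t 1 2 in \<open>simp add: algebra_simps\<close>)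
qed

text \<open>Both iterated derivatives are limits of the same second difference quotient.\<close>

lemma dird_commute:
  fixes f :: "'a::real_normed_vector \<Rightarrow> real"
  assumes f: "smooth f"
  shows "dird v (dird w f) x = dird w (dird v f) x"
proof -
  define h where "h n = inverse (real (Suc n))" for n
  have hpos: "0 < h n" for n by (simp add: h_def)
  have h0: "h \<longlonglongrightarrow> 0" unfolding h_def by (rule LIMSEQ_inverse_real_of_nat)
  have "\<exists>s t s' t'. 0 < s \<and> s < h n \<and> 0 < t \<and> t < h n \<and> 0 < s' \<and> s' < h n \<and> 0 < t' \<and> t' < h n \<and>
      dird w (dird v f) (x + s *\<^sub>R v + t *\<^sub>R w) = dird v (dird w f) (x + s' *\<^sub>R w + t' *\<^sub>R v)" for n
  proof -
    obtain s t where st: "0 < s" "s < h n" "0 < t" "t < h n" and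
      1: "f (x + h n *\<^sub>R v + h n *\<^sub>R w) - f (x + h n *\<^sub>R v) - f (x + h n *\<^sub>R w) + f x
        = h n * h n * dird w (dird v f) (x + s *\<^sub>R v + t *\<^sub>R w)"
      using second_difference_mvt[OF f hpos] by blast
    obtain s' t' where st': "0 < s'" "s' < h n" "0 < t'" "t' < h n" and
      2: "f (x + h n *\<^sub>R w + h n *\<^sub>R v) - f (x + h n *\<^sub>R w) - f (x + h n *\<^sub>R v) + f x
        = h n * h n * dird v (dird w f) (x + s' *\<^sub>R w + t' *\<^sub>R v)"
      using second_difference_mvt[OF f hpos] by blast
    have "h n * h n * dird w (dird v f) (x + s *\<^sub>R v + t *\<^sub>R w)
        = h n * h n * dird v (dird w f) (x + s' *\<^sub>R w + t' *\<^sub>R v)"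
      using 1 2 by (simp add: algebra_simps)
    then have "dird w (dird v f) (x + s *\<^sub>R v + t *\<^sub>R w) = dird v (dird w f) (x + s' *\<^sub>R w + t' *\<^sub>R v)"
      using hpos[of n] by simp
    then show ?thesis using st st' by blast
  qed
  then obtain s t s' t' where b: "\<And>n. 0 < s n \<and> s n < h n \<and> 0 < t n \<and> t n < h n \<and>
      0 < s' n \<and> s' n < h n \<and> 0 < t' n \<and> t' n < h n" and
    e: "\<And>n. dird w (dird v f) (x + s n *\<^sub>R v + t n *\<^sub>R w)
        = dird v (dird w f) (x + s' n *\<^sub>R w + t' n *\<^sub>R v)" by metis
  have lim: "r \<longlonglongrightarrow> 0" if "\<And>n. 0 < r n \<and> r n < h n" for r
    by (rule tendsto_sandwich[OF _ _ tendsto_const h0]) (auto intro!: always_eventually less_imp_le that[THEN conjunct1] that[THEN conjunct2])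
  have l: "s \<longlonglongrightarrow> 0" "t \<longlonglongrightarrow> 0" "s' \<longlonglongrightarrow> 0" "t' \<longlonglongrightarrow> 0" using b by (auto intro!: lim)
  have c1: "(\<lambda>n. dird w (dird v f) (x + s n *\<^sub>R v + t n *\<^sub>R w)) \<longlonglongrightarrow> dird w (dird v f) (x + 0 *\<^sub>R v + 0 *\<^sub>R w)"
    by (rule continuous_on_tendsto_compose[OF smooth_continuous_on[OF smooth_dird[OF smooth_dird[OF f]], of UNIV]])
      (auto intro!: tendsto_add[OF tendsto_add[OF tendsto_const tendsto_scaleR[OF l(1) tendsto_const]] tendsto_scaleR[OF l(2) tendsto_const], simplified])
  have c2: "(\<lambda>n. dird v (dird w f) (x + s' n *\<^sub>R w + t' n *\<^sub>R v)) \<longlonglongrightarrow> dird v (dird w f) (x + 0 *\<^sub>R w + 0 *\<^sub>R v)"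
    by (rule continuous_on_tendsto_compose[OF smooth_continuous_on[OF smooth_dird[OF smooth_dird[OF f]], of UNIV]])
      (auto intro!: tendsto_add[OF tendsto_add[OF tendsto_const tendsto_scaleR[OF l(3) tendsto_const]] tendsto_scaleR[OF l(4) tendsto_const], simplified])
  show ?thesis using LIMSEQ_unique[OF c1] c2 by (simp add: e)
qed

lemma smooth_local_max:
  fixes f :: "'a::real_normed_vector \<Rightarrow> real"
  assumes f: "smooth f" and e: "0 < e" and mx: "\<And>y. y \<in> ball p e \<Longrightarrow> f y \<le> f p"
  shows "dird v f p = 0" "dird v (dird v f) p \<le> 0"
proof -
  have z: "dird v f p = 0" for v
    using differential_zero_maxmin[OF _ open_ball smooth_has_derivative[OF f], of p p e] e mx
    by (metis centre_in_ball)
  then show "dird v f p = 0" .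
  show "dird v (dird v f) p \<le> 0"
  proof (rule ccontr)
    let ?\<phi> = "\<lambda>t. dird v f (p + t *\<^sub>R v)"
    assume "\<not> dird v (dird v f) p \<le> 0"
    then have pos: "0 < dird v (dird v f) (p + 0 *\<^sub>R v)" by simp
    from DERIV_pos_inc_right[OF smooth_line_deriv[OF smooth_dird[OF f]] this]
    obtain d where d: "d > 0" and inc: "\<And>t. 0 < t \<Longrightarrow> t < d \<Longrightarrow> ?\<phi> 0 < ?\<phi> t" by auto
    define t where "t = min (d/2) (e / (2 * (norm v + 1)))"
    have nv: "0 < 2 * (norm v + 1)" by (simp add: add_nonneg_pos)
    have t: "0 < t" "t < d" using d e nv by (auto simp: t_def min_less_iff_disj)
    have "t \<le> e / (2 * (norm v + 1))" by (simp add: t_def)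
    then have "t * (2 * (norm v + 1)) \<le> e" using nv by (simp add: pos_le_divide_eq)
    moreover have "0 \<le> t * norm v" using t(1) by simp
    moreover have "t * (2 * (norm v + 1)) = 2 * (t * norm v) + 2 * t" by (simp add: algebra_simps)
    ultimately have "t * norm v < e" using t(1) by linarith
    then have "p + t *\<^sub>R v \<in> ball p e" using t(1) by (simp add: dist_norm)
    moreover obtain s where "0 < s" "s < t" "f (p + t *\<^sub>R v) - f (p + 0 *\<^sub>R v) = (t - 0) * ?\<phi> s"
      using MVT2[OF t(1) smooth_line_deriv[OF f, of p v]] by auto
    moreover have "?\<phi> s > 0" using inc[of s] \<open>0<s\<close> \<open>s<t\<close> t z by simp
    ultimately have "0 < f (p + t *\<^sub>R v) - f p" "f (p + t *\<^sub>R v) \<le> f p"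
      using mx[of "p + t *\<^sub>R v"] t by auto
    then show False by simp
  qed
qed

lemma dird_cmult:
  fixes f :: "'a::real_normed_vector \<Rightarrow> real"
  assumes "smooth f" shows "dird v (\<lambda>x. c * f x) x = c * dird v f x"
  using dird_mult[OF differentiable_const smooth_differentiable[OF assms]] by simp

lemma dird_sum:
  fixes f :: "'i \<Rightarrow> 'a::real_normed_vector \<Rightarrow> real"
  assumes "\<And>i. i \<in> I \<Longrightarrow> smooth (f i)"
  shows "dird v (\<lambda>x. \<Sum>i\<in>I. f i x) x = (\<Sum>i\<in>I. dird v (f i) x)"
  using assms
proof (induction I rule: infinite_finite_induct)
  case (insert j I)
  then have "smooth (\<lambda>x. \<Sum>i\<in>I. f i x)" by (intro smooth_sum) auto
  with insert show ?case by (simp add: dird_add smooth_differentiable)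
qed auto

lemma dird_expand:
  fixes f :: "real^'m \<Rightarrow> real"
  assumes "smooth f"
  shows "dird v f x = (\<Sum>k\<in>UNIV. v $ k * dird (axis k 1) f x)"
  using linear_expand_axis[OF dird_linear[OF assms, of x], of v] by (simp only: real_scaleR_def)

lemma dird2_expand:
  fixes f :: "real^'m \<Rightarrow> real"
  assumes "smooth f"
  shows "dird v (dird w f) x = (\<Sum>k\<in>UNIV. \<Sum>l\<in>UNIV. v $ k * w $ l * dird (axis k 1) (dird (axis l 1) f) x)"
proof -
  have "dird v (dird w f) x = dird v (\<lambda>z. \<Sum>l\<in>UNIV. w $ l * dird (axis l 1) f z) x"
    by (simp only: dird_expand[OF assms, where v=w])
  also have "\<dots> = (\<Sum>l\<in>UNIV. w $ l * dird v (dird (axis l 1) f) x)"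
    by (subst dird_sum) (auto intro!: smooth_intros assms simp: dird_cmult smooth_dird[OF assms])
  also have "\<dots> = (\<Sum>l\<in>UNIV. w $ l * (\<Sum>k\<in>UNIV. v $ k * dird (axis k 1) (dird (axis l 1) f) x))"
    by (simp only: dird_expand[OF smooth_dird[OF assms], where v=v])
  also have "\<dots> = (\<Sum>l\<in>UNIV. \<Sum>k\<in>UNIV. v $ k * w $ l * dird (axis k 1) (dird (axis l 1) f) x)"
    by (simp add: sum_distrib_left mult_ac)
  finally show ?thesis by (subst sum.swap)
qed

section \<open>Commuting derivations dual to a system of coordinate functions\<close>

text \<open>The functions \<open>Y\<^sub>j\<close> are coordinates near every point, and the vector fields dual to their
  differentials are defined everywhere.\<close>

locale moving_frame =
  fixes Y :: "'m::finite \<Rightarrow> real^'m \<Rightarrow> real"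
  assumes smooth_Y: "smooth (Y j)"
    and immersive: "(\<And>j. dird v (Y j) x = 0) \<Longrightarrow> v = 0"
begin

definition J :: "real^'m \<Rightarrow> real^'m^'m" where
  "J x = (\<chi> j k. dird (axis k 1) (Y j) x)"

text \<open>Column \<open>i\<close> of \<open>S\<close> is the coordinate vector field of \<open>Y\<^sub>i\<close>, written in the standard basis.\<close>

definition S :: "real^'m \<Rightarrow> real^'m^'m" where
  "S x = matrix_inv (J x)"

definition D :: "real^'m \<Rightarrow> (real^'m \<Rightarrow> real) \<Rightarrow> real^'m \<Rightarrow> real" where
  "D v f x = dird (S x *v v) f x"

lemma J_mult: "J x *v v = (\<chi> j. dird v (Y j) x)"
  by (simp add: vec_eq_iff matrix_vector_mult_def J_def dird_expand[OF smooth_Y, where v=v] mult.commute)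

lemma det_J: "det (J x) \<noteq> 0"
  by (rule det_nonzero_if_kernel_trivial, rule immersive[where x = x]) (simp add: J_mult vec_eq_iff)

lemma J_S: "J x ** S x = mat 1" "S x ** J x = mat 1"
  using matrix_inv_cofactors[OF det_J] by (auto simp: S_def)

lemma J_S_mult: "J x *v (S x *v v) = v" "S x *v (J x *v v) = v"
  by (simp_all add: matrix_vector_mul_assoc J_S)

lemma D_Y: "D v (Y j) x = v $ j"
proof -
  have "D v (Y j) x = (J x *v (S x *v v)) $ j" by (simp add: D_def J_mult)
  then show ?thesis by (simp add: J_S_mult)
qed

lemma smooth_S: "smooth (\<lambda>x. S x $ i $ j)"
  unfolding S_def
  by (rule smooth_matrix_inv[OF _ det_J]) (simp only: J_def vec_lambda_beta smooth_dird smooth_Y)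

lemma smooth_S_mult: "smooth (\<lambda>x. (S x *v v) $ i)"
  unfolding matrix_vector_mult_def by (auto intro!: smooth_intros smooth_S)

lemma D_expand_dird:
  "smooth f \<Longrightarrow> D v f x = (\<Sum>k\<in>UNIV. (S x *v v) $ k * dird (axis k 1) f x)"
  unfolding D_def by (rule dird_expand)

lemma dird_D: "dird v f x = D (J x *v v) f x"
  by (simp add: D_def J_S_mult)

lemma smooth_D:
  assumes "smooth f" shows "smooth (D v f)"
  unfolding D_expand_dird[OF assms, abs_def]
  by (intro smooth_sum smooth_mult smooth_S_mult smooth_dird assms)

lemma D_const [simp]: "D v (\<lambda>x. c) x = 0"
  by (simp add: D_def)

lemma D_add: "smooth f \<Longrightarrow> smooth g \<Longrightarrow> D v (\<lambda>x. f x + g x) x = D v f x + D v g x"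
  by (simp add: D_def dird_add smooth_differentiable)

lemma D_mult: "smooth f \<Longrightarrow> smooth g \<Longrightarrow> D v (\<lambda>x. f x * g x) x = D v f x * g x + f x * D v g x"
  by (simp add: D_def dird_mult smooth_differentiable)

lemma D_cmult: "smooth f \<Longrightarrow> D v (\<lambda>x. c * f x) x = c * D v f x"
  by (simp add: D_def dird_cmult)

lemma D_diff: "smooth f \<Longrightarrow> smooth g \<Longrightarrow> D v (\<lambda>x. f x - g x) x = D v f x - D v g x"
  unfolding D_def
  by (rule fun_cong[OF frechet_derivative_at[symmetric]])
     (intro has_derivative_diff smooth_has_derivative)

lemma D_sum: "(\<And>i. i \<in> I \<Longrightarrow> smooth (f i)) \<Longrightarrow> D v (\<lambda>x. \<Sum>i\<in>I. f i x) x = (\<Sum>i\<in>I. D v (f i) x)"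
  by (simp add: D_def dird_sum)

lemma D_expand:
  assumes "smooth f"
  shows "D v f x = (\<Sum>i\<in>UNIV. v $ i * D (axis i 1) f x)"
proof -
  have "linear (\<lambda>v. D v f x)"
    unfolding D_def
    using linear_compose[OF matrix_vector_mul_linear dird_linear[OF assms]] by (simp add: o_def)
  from linear_expand_axis[OF this, of v] show ?thesis by (simp only: real_scaleR_def)
qed

text \<open>Two derivations composed are a second derivative along the frame plus a first-order term whose
  direction \<open>c\<close> is the same for all functions.  So \<open>c\<close> can be found by testing on
  the coordinate functions themselves, whose second derivatives in the frame vanish.\<close>

lemma D_D_expand:
  "\<exists>c. \<forall>f. smooth f \<longrightarrow> D v (D w f) x = dird (S x *v v) (dird (S x *v w) f) x + dird c f x"
proof (intro exI allI impI)
  fix f :: "real^'m \<Rightarrow> real" assume f: "smooth f"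
  let ?c = "\<chi> k. dird (S x *v v) (\<lambda>z. (S z *v w) $ k) x"
  have "D v (D w f) x = dird (S x *v v) (\<lambda>z. \<Sum>k\<in>UNIV. (S z *v w) $ k * dird (axis k 1) f z) x"
    by (simp only: D_expand_dird[OF f, abs_def]) (simp only: D_def)
  also have "\<dots> = (\<Sum>k\<in>UNIV. dird (S x *v v) (\<lambda>z. (S z *v w) $ k) x * dird (axis k 1) f x
      + (S x *v w) $ k * dird (S x *v v) (dird (axis k 1) f) x)"
    by (subst dird_sum)
      (auto intro!: smooth_mult smooth_S_mult smooth_dird f sum.cong
        simp: dird_mult[OF smooth_differentiable[OF smooth_S_mult] smooth_differentiable[OF smooth_dird[OF f]]])
  also have "\<dots> = dird ?c f x + (\<Sum>k\<in>UNIV. (S x *v w) $ k * dird (S x *v v) (dird (axis k 1) f) x)"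
    by (simp add: sum.distrib dird_expand[OF f, where v="?c"])
  also have "(\<Sum>k\<in>UNIV. (S x *v w) $ k * dird (S x *v v) (dird (axis k 1) f) x)
      = (\<Sum>k\<in>UNIV. dird (S x *v v) (\<lambda>z. (S x *v w) $ k * dird (axis k 1) f z) x)"
    by (simp add: dird_cmult smooth_dird[OF f])
  also have "\<dots> = dird (S x *v v) (\<lambda>z. \<Sum>k\<in>UNIV. (S x *v w) $ k * dird (axis k 1) f z) x"
    by (rule dird_sum[symmetric]) (intro smooth_cmult smooth_dird f)
  also have "(\<lambda>z. \<Sum>k\<in>UNIV. (S x *v w) $ k * dird (axis k 1) f z) = dird (S x *v w) f"
    by (simp only: dird_expand[OF f, where v="S x *v w"])
  finally show "D v (D w f) x = dird (S x *v v) (dird (S x *v w) f) x + dird ?c f x" by simp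
qed

lemma D_D_Y [simp]: "D v (D w (Y j)) x = 0"
proof -
  have "D w (Y j) = (\<lambda>x. w $ j)" by (rule ext) (rule D_Y)
  then show ?thesis by simp
qed

lemma dird_diff_direction: "smooth f \<Longrightarrow> dird (v - w) f x = dird v f x - dird w f x"
  using linear_diff[OF dird_linear] by blast

text \<open>The commutator is a vector field that annihilates all coordinate functions \<open>Y\<^sub>j\<close>.\<close>

lemma D_commute:
  assumes f: "smooth f" shows "D v (D w f) x = D w (D v f) x"
proof -
  obtain c where c: "\<And>f. smooth f \<Longrightarrow> D v (D w f) x = dird (S x *v v) (dird (S x *v w) f) x + dird c f x"
    using D_D_expand by blast
  obtain c' where c': "\<And>f. smooth f \<Longrightarrow> D w (D v f) x = dird (S x *v w) (dird (S x *v v) f) x + dird c' f x"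
    using D_D_expand by blast
  have e: "D v (D w f) x - D w (D v f) x = dird (c - c') f x" if "smooth f" for f
    using c[OF that] c'[OF that] dird_commute[OF that] dird_diff_direction[OF that] by simp
  have "c - c' = 0"
    by (rule immersive[where x=x]) (use e[OF smooth_Y] in simp)
  then show ?thesis using e[OF f] linear_0[OF dird_linear[OF f]] by simp
qed

lemma D_commute_fun: "smooth f \<Longrightarrow> D v (D w f) = D w (D v f)"
  by (rule ext) (rule D_commute)

text \<open>A second-order operator without zeroth-order term in the coordinates \<open>Y\<close>: the leading
  coefficients transform as a tensor, and the first-order coefficients are the values of the operator
  on the coordinate functions.  For a translating soliton these values are constants.\<close>

lemma second_order_operator_in_frame:
  fixes g :: "real^'m^'m" and a A :: "real^'m"
  assumes f: "smooth f"
    and A: "\<And>i. (\<Sum>k\<in>UNIV. \<Sum>l\<in>UNIV. g $ k $ l * dird (axis k 1) (dird (axis l 1) (Y i)) x) + dird a (Y i) x = A $ i"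
    and G: "G = J x ** g ** transpose (J x)"
  shows "(\<Sum>k\<in>UNIV. \<Sum>l\<in>UNIV. g $ k $ l * dird (axis k 1) (dird (axis l 1) f) x) + dird a f x
       = (\<Sum>i\<in>UNIV. \<Sum>j\<in>UNIV. G $ i $ j * D (axis i 1) (D (axis j 1) f) x) + D A f x"
proof -
  let ?h = "\<lambda>f k l. dird (axis k 1) (dird (axis l 1) f) x"
  obtain c where c: "\<And>i j f. smooth f \<Longrightarrow> D (axis i 1) (D (axis j 1) f) x
      = dird (S x *v axis i 1) (dird (S x *v axis j 1) f) x + dird (c i j) f x"
    using D_D_expand[of "axis _ 1" "axis _ 1" x] by metis
  define C where "C = (\<Sum>i\<in>UNIV. \<Sum>j\<in>UNIV. G $ i $ j *\<^sub>R c i j)"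
  have col: "(S x *v axis i 1) $ k = S x $ k $ i" for i k
    by (simp add: matrix_vector_mult_def axis_def if_distrib cong: if_cong)
  have gS: "g = S x ** G ** transpose (S x)"
  proof -
    have "transpose (J x) ** transpose (S x) = mat 1"
      by (simp only: matrix_transpose_mul[symmetric] J_S transpose_mat)
    moreover have "S x ** G ** transpose (S x)
        = (S x ** J x) ** g ** (transpose (J x) ** transpose (S x))"
      unfolding G by (simp only: matrix_mul_assoc)
    ultimately show ?thesis by (simp add: J_S matrix_mul_lid matrix_mul_rid)
  qed
  have gkl: "g $ k $ l = (\<Sum>i\<in>UNIV. \<Sum>j\<in>UNIV. G $ i $ j * (S x $ k $ i * S x $ l $ j))" for k l
  proof -
    have "g $ k $ l = (\<Sum>j\<in>UNIV. (\<Sum>i\<in>UNIV. S x $ k $ i * G $ i $ j) * S x $ l $ j)"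
      by (subst gS) (simp add: matrix_matrix_mult_def transpose_def)
    also have "\<dots> = (\<Sum>j\<in>UNIV. \<Sum>i\<in>UNIV. G $ i $ j * (S x $ k $ i * S x $ l $ j))"
      by (simp add: sum_distrib_right sum_distrib_left mult_ac)
    finally show ?thesis by (subst sum.swap)
  qed
  have main: "(\<Sum>i\<in>UNIV. \<Sum>j\<in>UNIV. G $ i $ j * D (axis i 1) (D (axis j 1) f) x)
      = (\<Sum>k\<in>UNIV. \<Sum>l\<in>UNIV. g $ k $ l * ?h f k l) + dird C f x" if f: "smooth f" for f
  proof -
    interpret lin: linear "\<lambda>v. dird v f x" by (rule dird_linear[OF f])
    have h: "dird (S x *v axis i 1) (dird (S x *v axis j 1) f) x
        = (\<Sum>k\<in>UNIV. \<Sum>l\<in>UNIV. S x $ k $ i * S x $ l $ j * ?h f k l)" for i j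
      by (subst dird2_expand[OF f]) (simp only: col)
    have "(\<Sum>i\<in>UNIV. \<Sum>j\<in>UNIV. G $ i $ j * D (axis i 1) (D (axis j 1) f) x)
      = (\<Sum>i\<in>UNIV. \<Sum>j\<in>UNIV. G $ i $ j * (\<Sum>k\<in>UNIV. \<Sum>l\<in>UNIV. S x $ k $ i * S x $ l $ j * ?h f k l))
        + (\<Sum>i\<in>UNIV. \<Sum>j\<in>UNIV. G $ i $ j * dird (c i j) f x)"
      by (simp only: c[OF f] h distrib_left sum.distrib)
    also have "(\<Sum>i\<in>UNIV. \<Sum>j\<in>UNIV. G $ i $ j * dird (c i j) f x) = dird C f x"
      by (simp add: C_def lin.sum lin.scale)
    also have "(\<Sum>i\<in>UNIV. \<Sum>j\<in>UNIV. G $ i $ j * (\<Sum>k\<in>UNIV. \<Sum>l\<in>UNIV. S x $ k $ i * S x $ l $ j * ?h f k l))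
        = (\<Sum>i\<in>UNIV. \<Sum>j\<in>UNIV. \<Sum>k\<in>UNIV. \<Sum>l\<in>UNIV. G $ i $ j * (S x $ k $ i * S x $ l $ j) * ?h f k l)"
      by (simp add: sum_distrib_left mult_ac)
    also have "\<dots> = (\<Sum>i\<in>UNIV. \<Sum>k\<in>UNIV. \<Sum>j\<in>UNIV. \<Sum>l\<in>UNIV. G $ i $ j * (S x $ k $ i * S x $ l $ j) * ?h f k l)"
      by (rule sum.cong[OF refl], rule sum.swap)
    also have "\<dots> = (\<Sum>k\<in>UNIV. \<Sum>i\<in>UNIV. \<Sum>l\<in>UNIV. \<Sum>j\<in>UNIV. G $ i $ j * (S x $ k $ i * S x $ l $ j) * ?h f k l)"
      by (subst sum.swap, rule sum.cong[OF refl], rule sum.cong[OF refl], rule sum.swap)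
    also have "\<dots> = (\<Sum>k\<in>UNIV. \<Sum>l\<in>UNIV. \<Sum>i\<in>UNIV. \<Sum>j\<in>UNIV. G $ i $ j * (S x $ k $ i * S x $ l $ j) * ?h f k l)"
      by (rule sum.cong[OF refl], rule sum.swap)
    also have "\<dots> = (\<Sum>k\<in>UNIV. \<Sum>l\<in>UNIV. g $ k $ l * ?h f k l)"
      by (simp add: gkl sum_distrib_right)
    finally show ?thesis .
  qed
  have "J x *v C = J x *v a - A"
  proof (simp add: vec_eq_iff J_mult, intro allI)
    fix i
    show "dird C (Y i) x = dird a (Y i) x - A $ i"
      using main[OF smooth_Y[of i]] A[of i] by simp
  qed
  then have "dird C f x = D (J x *v a - A) f x" by (subst dird_D) simp
  also have "\<dots> = dird a f x - D A f x"
    by (simp only: D_def matrix_vector_mult_diff_distrib J_S_mult dird_diff_direction[OF f])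
  finally show ?thesis using main[OF f] by linarith
qed

lemma D2_mult:
  assumes "smooth f" "smooth g"
  shows "D v (D v (\<lambda>x. f x * g x)) x = D v (D v f) x * g x + 2 * (D v f x * D v g x) + f x * D v (D v g) x"
proof -
  have "D v (\<lambda>x. f x * g x) = (\<lambda>x. D v f x * g x + f x * D v g x)"
    by (rule ext) (rule D_mult[OF assms])
  then show ?thesis
    by (simp add: D_add D_mult smooth_mult smooth_D assms)
qed

lemma D2_add:
  assumes "smooth f" "smooth g"
  shows "D v (D v (\<lambda>x. f x + g x)) x = D v (D v f) x + D v (D v g) x"
proof -
  have "D v (\<lambda>x. f x + g x) = (\<lambda>x. D v f x + D v g x)"
    by (rule ext) (rule D_add[OF assms])
  then show ?thesis by (simp add: D_add smooth_D assms)
qed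

lemma D2_diff:
  assumes "smooth f" "smooth g"
  shows "D v (D v (\<lambda>x. f x - g x)) x = D v (D v f) x - D v (D v g) x"
proof -
  have "D v (\<lambda>x. f x - g x) = (\<lambda>x. D v f x - D v g x)"
    by (rule ext) (rule D_diff[OF assms])
  then show ?thesis by (simp add: D_diff smooth_D assms)
qed

lemma D2_cmult:
  assumes "smooth f"
  shows "D v (D v (\<lambda>x. c * f x)) x = c * D v (D v f) x"
proof -
  have "D v (\<lambda>x. c * f x) = (\<lambda>x. c * D v f x)"
    by (rule ext) (rule D_cmult[OF assms])
  then show ?thesis by (simp add: D_cmult smooth_D assms)
qed

lemma D2_sum:
  assumes "\<And>i. i \<in> I \<Longrightarrow> smooth (f i)"
  shows "D v (D v (\<lambda>x. \<Sum>i\<in>I. f i x)) x = (\<Sum>i\<in>I. D v (D v (f i)) x)"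
proof -
  have "D v (\<lambda>x. \<Sum>i\<in>I. f i x) = (\<lambda>x. \<Sum>i\<in>I. D v (f i) x)"
    by (rule ext) (rule D_sum[OF assms])
  then show ?thesis by (simp add: D_sum smooth_D assms)
qed

lemma D_const_fun [simp]: "D v (\<lambda>x. c) = (\<lambda>x. 0)"
  by (rule ext) simp

lemma D2_expand:
  assumes f: "smooth f"
  shows "D v (D w f) x = (\<Sum>i\<in>UNIV. \<Sum>j\<in>UNIV. v $ i * w $ j * D (axis i 1) (D (axis j 1) f) x)"
proof -
  have "D w f = (\<lambda>x. \<Sum>j\<in>UNIV. w $ j * D (axis j 1) f x)"
    by (rule ext) (rule D_expand[OF f])
  then have "D v (D w f) x = D v (\<lambda>x. \<Sum>j\<in>UNIV. w $ j * D (axis j 1) f x) x" by simp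
  also have "\<dots> = (\<Sum>j\<in>UNIV. w $ j * D v (D (axis j 1) f) x)"
    by (simp add: D_sum D_cmult smooth_D smooth_cmult f)
  also have "\<dots> = (\<Sum>j\<in>UNIV. w $ j * (\<Sum>i\<in>UNIV. v $ i * D (axis i 1) (D (axis j 1) f) x))"
    by (intro sum.cong refl arg_cong2[where f="(*)"] D_expand smooth_D f)
  also have "\<dots> = (\<Sum>j\<in>UNIV. \<Sum>i\<in>UNIV. v $ i * w $ j * D (axis i 1) (D (axis j 1) f) x)"
    by (simp add: sum_distrib_left mult_ac)
  finally show ?thesis by (subst sum.swap)
qed

text \<open>The first-order term in \<open>D_D_expand\<close> vanishes at a critical point.\<close>

lemma D_local_max:
  assumes f: "smooth f" and e: "0 < e" and mx: "\<And>y. y \<in> ball p e \<Longrightarrow> f y \<le> f p"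
  shows "D v f p = 0" "D v (D v f) p \<le> 0"
proof -
  have 1: "dird u f p = 0" for u by (rule smooth_local_max(1)[OF f e mx])
  have 2: "dird u (dird u f) p \<le> 0" for u by (rule smooth_local_max(2)[OF f e mx])
  show "D v f p = 0" by (simp add: D_def 1)
  obtain c where "D v (D v f) p = dird (S p *v v) (dird (S p *v v) f) p + dird c f p"
    using D_D_expand f by blast
  then show "D v (D v f) p \<le> 0" using 1[of c] 2[of "S p *v v"] by simp
qed

end

section \<open>The differential inequality at a point with horizontal tangent space\<close>

text \<open>The translator equation as it looks in the coordinates \<open>Y\<close> after an isometry that makes the
  tangent space at \<open>p\<close> horizontal.  The graph has heights \<open>w\<close> over these coordinates and metric
  \<open>\<delta>\<^sub>i\<^sub>j - D\<^sub>i w \<bullet> D\<^sub>j w\<close>, with inverse \<open>G\<close>; the vector \<open>(A, b)\<close> is the translation vector.\<close>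

locale soliton_frame = moving_frame Y
  for Y :: "'m::finite \<Rightarrow> real^'m \<Rightarrow> real" +
  fixes w :: "'n::finite \<Rightarrow> real^'m \<Rightarrow> real" and G :: "'m \<Rightarrow> 'm \<Rightarrow> real^'m \<Rightarrow> real"
    and A :: "real^'m" and b :: "'n \<Rightarrow> real" and p :: "real^'m"
  assumes smooth_w: "smooth (w \<alpha>)" and smooth_G: "smooth (G i j)"
    and G_inverse: "(\<Sum>j\<in>UNIV. G i j x * ((if j = k then 1 else 0) -
        (\<Sum>\<alpha>\<in>UNIV. D (axis j 1) (w \<alpha>) x * D (axis k 1) (w \<alpha>) x))) = (if i = k then 1 else 0)"
    and equation: "(\<Sum>i\<in>UNIV. \<Sum>j\<in>UNIV. G i j x * D (axis i 1) (D (axis j 1) (w \<alpha>)) x) + D A (w \<alpha>) x = b \<alpha>"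
    and critical: "D v (w \<alpha>) p = 0"
begin

abbreviation E :: "'m \<Rightarrow> real^'m" where "E i \<equiv> axis i 1"

definition metric :: "'m \<Rightarrow> 'm \<Rightarrow> real^'m \<Rightarrow> real" where
  "metric j k x = (if j = k then 1 else 0) - (\<Sum>\<alpha>\<in>UNIV. D (E j) (w \<alpha>) x * D (E k) (w \<alpha>) x)"

lemmas smooth_frame_intros = smooth_const smooth_sum smooth_mult smooth_diff smooth_D smooth_w smooth_G smooth_cmult smooth_add

text \<open>The metric and the factors that normalise tangent and normal vectors all have this
  form, with first derivatives of \<open>w\<close> as factors.\<close>

lemma sum_products_at_critical_point:
  assumes "\<And>i. smooth (f i)" "\<And>i. smooth (g i)" "\<And>i. f i p = 0" "\<And>i. g i p = 0"
  shows "D v (\<lambda>x. c - (\<Sum>i\<in>I. f i x * g i x)) p = 0"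
    "D v (D v (\<lambda>x. c - (\<Sum>i\<in>I. f i x * g i x))) p = - 2 * (\<Sum>i\<in>I. D v (f i) p * D v (g i) p)"
  using assms
  by (simp_all add: D_diff D2_diff D_sum D2_sum D_mult D2_mult smooth_frame_intros sum_distrib_left sum_negf)

lemma smooth_metric: "smooth (metric j k)"
  unfolding metric_def[abs_def] by (intro smooth_frame_intros)

lemma metric_p: "metric j k p = (if j = k then 1 else 0)"
  by (simp add: metric_def critical)

lemma D_metric_p: "D v (metric j k) p = 0"
  unfolding metric_def[abs_def]
  by (rule sum_products_at_critical_point) (auto intro!: smooth_frame_intros simp: critical)

lemma D2_metric_p:
  "D v (D v (metric j k)) p = - 2 * (\<Sum>\<alpha>\<in>UNIV. D v (D (E j) (w \<alpha>)) p * D v (D (E k) (w \<alpha>)) p)"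
  unfolding metric_def[abs_def]
  by (rule sum_products_at_critical_point) (auto intro!: smooth_frame_intros simp: critical)

lemma G_metric: "(\<Sum>j\<in>UNIV. G i j x * metric j k x) = (if i = k then 1 else 0)"
  using G_inverse by (simp only: metric_def)

lemma sum_delta_right: "(\<Sum>j\<in>UNIV. f j * (if j = k then 1 else 0)) = (f k :: real)" for k :: 'm
  by (simp add: if_distrib cong: if_cong)

lemma G_p: "G i k p = (if i = k then 1 else 0)"
  using G_metric[of i p k] by (simp only: metric_p sum_delta_right)

lemma DG_p: "D v (G i k) p = 0"
proof -
  have "D v (\<lambda>x. \<Sum>j\<in>UNIV. G i j x * metric j k x) p = 0" by (simp only: G_metric D_const)
  then show ?thesis
    by (simp only: D_sum D_mult smooth_frame_intros smooth_metric D_metric_p metric_p sum_delta_right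
        mult_zero_right add_0_right)
qed

text \<open>The second derivative of an inverse matrix where the matrix is the identity to first
  order.\<close>

lemma D2G_p:
  "D v (D v (G i k)) p = 2 * (\<Sum>\<alpha>\<in>UNIV. D v (D (E i) (w \<alpha>)) p * D v (D (E k) (w \<alpha>)) p)"
proof -
  have "D v (D v (\<lambda>x. \<Sum>j\<in>UNIV. G i j x * metric j k x)) p = 0"
    by (simp only: G_metric D_const D_const_fun)
  then have "(\<Sum>j\<in>UNIV. D v (D v (G i j)) p * (if j = k then 1 else 0))
      + (\<Sum>j\<in>UNIV. D v (D v (metric j k)) p * (if j = i then 1 else 0)) = 0"
    by (simp add: D2_sum D2_mult smooth_frame_intros smooth_metric D_metric_p metric_p DG_p G_p sum.distrib
        mult.commute eq_commute[of i])
  then show ?thesis by (simp only: sum_delta_right D2_metric_p)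
qed

text \<open>The component of \<open>w\<close> in a fixed vertical direction.\<close>

definition height :: "real^'n \<Rightarrow> real^'m \<Rightarrow> real" where
  "height \<xi> x = (\<Sum>\<alpha>\<in>UNIV. \<xi> $ \<alpha> * w \<alpha> x)"

lemma smooth_height: "smooth (height \<xi>)"
  unfolding height_def[abs_def] by (intro smooth_frame_intros)

lemma D_height: "D v (height \<xi>) x = (\<Sum>\<alpha>\<in>UNIV. \<xi> $ \<alpha> * D v (w \<alpha>) x)"
  unfolding height_def[abs_def] by (simp add: D_sum D_cmult smooth_frame_intros)

lemma D_height_fun: "D v (height \<xi>) = (\<lambda>x. \<Sum>\<alpha>\<in>UNIV. \<xi> $ \<alpha> * D v (w \<alpha>) x)"
  by (rule ext) (rule D_height)

lemma D_D_height: "D u (D v (height \<xi>)) x = (\<Sum>\<alpha>\<in>UNIV. \<xi> $ \<alpha> * D u (D v (w \<alpha>)) x)"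
  unfolding D_height_fun by (simp add: D_sum D_cmult smooth_frame_intros)

lemma equation_height:
  "(\<Sum>i\<in>UNIV. \<Sum>j\<in>UNIV. G i j x * D (E i) (D (E j) (height \<xi>)) x) + D A (height \<xi>) x
    = (\<Sum>\<alpha>\<in>UNIV. \<xi> $ \<alpha> * b \<alpha>)"
proof -
  have "(\<Sum>\<alpha>\<in>UNIV. \<xi> $ \<alpha> * b \<alpha>)
      = (\<Sum>\<alpha>\<in>UNIV. \<Sum>i\<in>UNIV. \<Sum>j\<in>UNIV. G i j x * (\<xi> $ \<alpha> * D (E i) (D (E j) (w \<alpha>)) x)) + D A (height \<xi>) x"
    by (simp add: D_height equation[of x, symmetric] distrib_left sum.distrib sum_distrib_left mult.left_commute)
  also have "(\<Sum>\<alpha>\<in>UNIV. \<Sum>i\<in>UNIV. \<Sum>j\<in>UNIV. G i j x * (\<xi> $ \<alpha> * D (E i) (D (E j) (w \<alpha>)) x))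
      = (\<Sum>i\<in>UNIV. \<Sum>\<alpha>\<in>UNIV. \<Sum>j\<in>UNIV. G i j x * (\<xi> $ \<alpha> * D (E i) (D (E j) (w \<alpha>)) x))"
    by (rule sum.swap)
  also have "\<dots> = (\<Sum>i\<in>UNIV. \<Sum>j\<in>UNIV. \<Sum>\<alpha>\<in>UNIV. G i j x * (\<xi> $ \<alpha> * D (E i) (D (E j) (w \<alpha>)) x))"
    by (rule sum.cong[OF refl], rule sum.swap)
  also have "\<dots> = (\<Sum>i\<in>UNIV. \<Sum>j\<in>UNIV. G i j x * D (E i) (D (E j) (height \<xi>)) x)"
    by (simp add: D_D_height sum_distrib_left)
  finally show ?thesis by simp
qed

text \<open>The equation differentiated twice in the direction \<open>v\<close>.  At \<open>p\<close> the coefficients are the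
  identity with vanishing first derivative, so besides the fourth derivatives only the second
  derivatives of the coefficients survive.\<close>

lemma laplacian_second_derivative:
  "(\<Sum>i\<in>UNIV. D (E i) (D (E i) (D v (D v (height \<xi>)))) p) + D A (D v (D v (height \<xi>))) p
    = - 2 * (\<Sum>i\<in>UNIV. \<Sum>j\<in>UNIV. (\<Sum>\<alpha>\<in>UNIV. D v (D (E i) (w \<alpha>)) p * D v (D (E j) (w \<alpha>)) p)
        * D (E i) (D (E j) (height \<xi>)) p)"
proof -
  have sm: "smooth (D (E i) (D (E j) (height \<xi>)))" for i j by (intro smooth_D smooth_height)
  have "D v (D v (\<lambda>x. (\<Sum>i\<in>UNIV. \<Sum>j\<in>UNIV. G i j x * D (E i) (D (E j) (height \<xi>)) x) + D A (height \<xi>) x)) p = 0"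
    by (simp only: equation_height D_const D_const_fun)
  moreover have "D v (D v (\<lambda>x. (\<Sum>i\<in>UNIV. \<Sum>j\<in>UNIV. G i j x * D (E i) (D (E j) (height \<xi>)) x) + D A (height \<xi>) x)) p
      = (\<Sum>i\<in>UNIV. \<Sum>j\<in>UNIV. D v (D v (\<lambda>x. G i j x * D (E i) (D (E j) (height \<xi>)) x)) p) + D v (D v (D A (height \<xi>))) p"
    by (simp add: D2_add D2_sum smooth_frame_intros smooth_height)
  moreover have "D v (D v (\<lambda>x. G i j x * D (E i) (D (E j) (height \<xi>)) x)) p
      = 2 * ((\<Sum>\<alpha>\<in>UNIV. D v (D (E i) (w \<alpha>)) p * D v (D (E j) (w \<alpha>)) p) * D (E i) (D (E j) (height \<xi>)) p)
        + D v (D v (D (E i) (D (E j) (height \<xi>)))) p * (if j = i then 1 else 0)" for i j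
    by (simp only: D2_mult smooth_G sm D2G_p DG_p G_p) (simp add: mult_ac)
  moreover have "D v (D v (D u (D u' (height \<xi>)))) = D u (D u' (D v (D v (height \<xi>))))" for u u'
    by (simp only: D_commute_fun[of _ v u] D_commute_fun[of _ v u'] smooth_D smooth_height)
  moreover have "D v (D v (D A (height \<xi>))) = D A (D v (D v (height \<xi>)))"
    by (simp only: D_commute_fun[of _ v A] smooth_D smooth_height)
  ultimately show ?thesis
    by (simp only: sum.distrib sum_distrib_left[symmetric] sum_delta_right)
qed

text \<open>The trace of the product of a positive semidefinite matrix, a sum of squares
  \<open>\<Sum>\<^sub>\<alpha> z\<^sub>\<alpha> z\<^sub>\<alpha>\<^sup>T\<close>, with the Hessian: each summand is the Hessian evaluated on \<open>z\<^sub>\<alpha>\<close>.\<close>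

lemma gradient_trace_bound:
  assumes dir: "\<And>z. D z (D z (height \<xi>)) p \<le> \<sigma> * (norm z)\<^sup>2"
  shows "(\<Sum>i\<in>UNIV. \<Sum>j\<in>UNIV. (\<Sum>\<alpha>\<in>UNIV. D v (D (E i) (w \<alpha>)) p * D v (D (E j) (w \<alpha>)) p)
        * D (E i) (D (E j) (height \<xi>)) p) \<le> \<sigma> * (\<Sum>\<alpha>\<in>UNIV. \<Sum>i\<in>UNIV. (D v (D (E i) (w \<alpha>)) p)\<^sup>2)"
proof -
  define z :: "'n \<Rightarrow> real^'m" where "z \<alpha> = (\<chi> i. D v (D (E i) (w \<alpha>)) p)" for \<alpha>
  let ?h = "\<lambda>i j. D (E i) (D (E j) (height \<xi>)) p"
  have "(\<Sum>i\<in>UNIV. \<Sum>j\<in>UNIV. (\<Sum>\<alpha>\<in>UNIV. z \<alpha> $ i * z \<alpha> $ j) * ?h i j)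
      = (\<Sum>i\<in>UNIV. \<Sum>\<alpha>\<in>UNIV. \<Sum>j\<in>UNIV. z \<alpha> $ i * z \<alpha> $ j * ?h i j)"
    by (simp only: sum_distrib_right) (rule sum.cong[OF refl], rule sum.swap)
  also have "\<dots> = (\<Sum>\<alpha>\<in>UNIV. \<Sum>i\<in>UNIV. \<Sum>j\<in>UNIV. z \<alpha> $ i * z \<alpha> $ j * ?h i j)"
    by (rule sum.swap)
  also have "\<dots> = (\<Sum>\<alpha>\<in>UNIV. D (z \<alpha>) (D (z \<alpha>) (height \<xi>)) p)"
    by (simp only: D2_expand[OF smooth_height, of "z _" "z _"])
  also have "\<dots> \<le> (\<Sum>\<alpha>\<in>UNIV. \<sigma> * (norm (z \<alpha>))\<^sup>2)"
    by (intro sum_mono dir)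
  also have "\<dots> = \<sigma> * (\<Sum>\<alpha>\<in>UNIV. \<Sum>i\<in>UNIV. (z \<alpha> $ i)\<^sup>2)"
    by (simp only: power2_norm_eq_inner inner_vec_def sum_distrib_left)
      (simp add: power2_eq_square)
  finally show ?thesis by (simp add: z_def)
qed

text \<open>Expand the squared norm of the Hessian minus \<open>\<sigma> v v\<^sup>T\<close>, where \<open>\<sigma>\<close> is its value on \<open>v\<close>.\<close>

lemma hessian_square_bound:
  assumes "norm v = 1"
  shows "(D v (D v (height \<xi>)) p)\<^sup>2 \<le> (\<Sum>i\<in>UNIV. \<Sum>j\<in>UNIV. (D (E i) (D (E j) (height \<xi>)) p)\<^sup>2)"
proof -
  let ?h = "\<lambda>i j. D (E i) (D (E j) (height \<xi>)) p"
  define \<sigma> where "\<sigma> = D v (D v (height \<xi>)) p"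
  have s: "\<sigma> = (\<Sum>i\<in>UNIV. \<Sum>j\<in>UNIV. v $ i * v $ j * ?h i j)"
    unfolding \<sigma>_def by (rule D2_expand[OF smooth_height])
  have v: "(\<Sum>i\<in>UNIV. (v $ i)\<^sup>2) = 1"
    using assms by (simp add: norm_eq_1 inner_vec_def power2_eq_square)
  have "0 \<le> (\<Sum>i\<in>UNIV. \<Sum>j\<in>UNIV. (?h i j - \<sigma> * (v $ i * v $ j))\<^sup>2)"
    by (intro sum_nonneg) simp
  also have "\<dots> = (\<Sum>i\<in>UNIV. \<Sum>j\<in>UNIV. (?h i j)\<^sup>2 - 2 * \<sigma> * (v $ i * v $ j * ?h i j)
      + \<sigma>\<^sup>2 * ((v $ i)\<^sup>2 * (v $ j)\<^sup>2))"
    by (intro sum.cong refl) (simp add: power2_eq_square algebra_simps)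
  also have "\<dots> = (\<Sum>i\<in>UNIV. \<Sum>j\<in>UNIV. (?h i j)\<^sup>2) - 2 * \<sigma> * (\<Sum>i\<in>UNIV. \<Sum>j\<in>UNIV. v $ i * v $ j * ?h i j)
      + \<sigma>\<^sup>2 * ((\<Sum>i\<in>UNIV. (v $ i)\<^sup>2) * (\<Sum>j\<in>UNIV. (v $ j)\<^sup>2))"
    by (simp only: sum.distrib sum_subtractf sum_distrib_left[symmetric] sum_distrib_right[symmetric])
  also have "\<dots> = (\<Sum>i\<in>UNIV. \<Sum>j\<in>UNIV. (?h i j)\<^sup>2) - \<sigma>\<^sup>2"
    by (simp only: s[symmetric] v) (simp add: power2_eq_square)
  finally show ?thesis by (simp add: \<sigma>_def)
qed

text \<open>The maximum principle at \<open>p\<close> for \<open>\<eta> D\<^sub>v D\<^sub>v \<omega>\<close> divided by the squared length of the field \<open>v\<close> and by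
  the length of the normal field \<open>\<nu>\<close> (\<open>\<omega>\<close> being the height along \<open>\<nu>\<close>).  The division is avoided by
  moving the normalisation to the other side.  The length of the normal is a square root \<open>\<surd>k\<close> with
  \<open>k = 1\<close> at \<open>p\<close>; it is replaced by \<open>(1 + k) / 2\<close>, which bounds it from above and has, since
  \<open>k\<close> is critical at \<open>p\<close>, the same derivatives there up to second order.\<close>

lemma weighted_maximum_inequality:
  fixes \<eta> :: "real^'m \<Rightarrow> real"
  assumes eta: "smooth \<eta>" "0 < \<eta> p" and v: "norm v = 1"
    and \<sigma>: "\<sigma> = D v (D v (height \<xi>)) p" "0 < \<sigma>"
    and dir: "\<And>z. D z (D z (height \<xi>)) p \<le> \<sigma> * (norm z)\<^sup>2"
    and r: "0 < r"
    and mx: "\<And>x. x \<in> ball p r \<Longrightarrow> \<eta> x * D v (D v (height \<xi>)) x \<le>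
      \<eta> p * \<sigma> * ((1 - (\<Sum>\<alpha>\<in>UNIV. D v (w \<alpha>) x * D v (w \<alpha>) x))
        * (1 - (\<Sum>j\<in>UNIV. 1/2 * D (E j) (height \<xi>) x * D (E j) (height \<xi>) x)))"
  shows "(\<eta> p * \<sigma>)\<^sup>2 \<le> 2 * (\<Sum>i\<in>UNIV. (D (E i) \<eta> p)\<^sup>2)
      - \<eta> p * ((\<Sum>i\<in>UNIV. D (E i) (D (E i) \<eta>) p) + D A \<eta> p)"
proof -
  define s where "s = D v (D v (height \<xi>))"
  define g where "g = (\<lambda>x. 1 - (\<Sum>\<alpha>\<in>UNIV. D v (w \<alpha>) x * D v (w \<alpha>) x))"
  define K where "K = (\<lambda>x. 1 - (\<Sum>j\<in>UNIV. (1/2 * D (E j) (height \<xi>) x) * D (E j) (height \<xi>) x))"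
  define Z where "Z = (\<lambda>x. \<eta> x * s x - \<eta> p * \<sigma> * (g x * K x))"
  have height_p: "D u (height \<xi>) p = 0" for u by (simp add: D_height critical)
  have sm: "smooth s" "smooth g" "smooth K"
    unfolding s_def g_def K_def by (intro smooth_frame_intros smooth_height)+
  have smZ: "smooth Z" unfolding Z_def by (intro smooth_frame_intros sm eta)
  have gp: "g p = 1" "K p = 1" by (simp_all add: g_def K_def critical height_p)
  have D1: "D u g p = 0" "D u K p = 0" for u
    unfolding g_def K_def
    by (rule sum_products_at_critical_point; (intro smooth_frame_intros smooth_height | simp add: critical height_p))+
  have D2g: "D (E i) (D (E i) g) p = - 2 * (\<Sum>\<alpha>\<in>UNIV. (D v (D (E i) (w \<alpha>)) p)\<^sup>2)" for i
  proof -
    have "D (E i) (D (E i) g) p = - 2 * (\<Sum>\<alpha>\<in>UNIV. D (E i) (D v (w \<alpha>)) p * D (E i) (D v (w \<alpha>)) p)"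
      unfolding g_def
      by (rule sum_products_at_critical_point) (auto intro!: smooth_frame_intros smooth_height simp: critical height_p)
    then show ?thesis by (simp add: power2_eq_square D_commute[OF smooth_w, of v])
  qed
  have D2K: "D (E i) (D (E i) K) p = - (\<Sum>j\<in>UNIV. (D (E i) (D (E j) (height \<xi>)) p)\<^sup>2)" for i
  proof -
    have "D (E i) (D (E i) K) p
        = - 2 * (\<Sum>j\<in>UNIV. D (E i) (\<lambda>x. 1/2 * D (E j) (height \<xi>) x) p * D (E i) (D (E j) (height \<xi>)) p)"
      unfolding K_def
      by (rule sum_products_at_critical_point) ((intro smooth_frame_intros smooth_height)+, simp_all add: height_p)
    then show ?thesis
      by (simp only: D_cmult smooth_D smooth_height) (simp add: power2_eq_square sum_distrib_left sum_negf)
  qed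
  have sp: "s p = \<sigma>" by (simp add: s_def \<sigma>)
  have Zmax: "Z x \<le> Z p" if "x \<in> ball p r" for x
    using mx[OF that] by (simp add: Z_def s_def[symmetric] sp gp) (simp add: g_def K_def)
  note max = D_local_max[OF smZ r Zmax]
  \<comment> \<open>\<open>Z\<close> is maximal at \<open>p\<close>; the normalising factors \<open>g\<close> and \<open>K\<close> are \<open>1\<close> there, with derivative \<open>0\<close>.\<close>
  have D1Z: "D u \<eta> p * \<sigma> + \<eta> p * D u s p = 0" for u
  proof -
    have "D u Z p = D u \<eta> p * \<sigma> + \<eta> p * D u s p"
      unfolding Z_def using D1[of u] by (simp add: D_diff D_cmult D_mult smooth_frame_intros sm eta sp)
    then show ?thesis using max(1)[of u] by simp
  qed
  have D2Z: "D (E i) (D (E i) \<eta>) p * \<sigma> + 2 * (D (E i) \<eta> p * D (E i) s p) + \<eta> p * D (E i) (D (E i) s) p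
      + \<eta> p * \<sigma> * (2 * (\<Sum>\<alpha>\<in>UNIV. (D v (D (E i) (w \<alpha>)) p)\<^sup>2)
          + (\<Sum>j\<in>UNIV. (D (E i) (D (E j) (height \<xi>)) p)\<^sup>2)) \<le> 0" for i
  proof -
    have "D (E i) (D (E i) Z) p = D (E i) (D (E i) \<eta>) p * \<sigma> + 2 * (D (E i) \<eta> p * D (E i) s p)
        + \<eta> p * D (E i) (D (E i) s) p - \<eta> p * \<sigma> * (D (E i) (D (E i) g) p + D (E i) (D (E i) K) p)"
      unfolding Z_def
      by (simp only: D2_diff D2_cmult D2_mult smooth_frame_intros sm eta sp D1 gp) simp
    then show ?thesis using max(2)[of "E i"] by (simp only: D2g D2K) (simp add: algebra_simps)
  qed
  define T where "T = (\<Sum>i\<in>UNIV. \<Sum>\<alpha>\<in>UNIV. (D v (D (E i) (w \<alpha>)) p)\<^sup>2)"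
  define N where "N = (\<Sum>i\<in>UNIV. \<Sum>j\<in>UNIV. (D (E i) (D (E j) (height \<xi>)) p)\<^sup>2)"
  define Q where "Q = (\<Sum>i\<in>UNIV. (D (E i) \<eta> p)\<^sup>2)"
  define L\<eta> where "L\<eta> = (\<Sum>i\<in>UNIV. D (E i) (D (E i) \<eta>) p)"
  define Ls where "Ls = (\<Sum>i\<in>UNIV. D (E i) (D (E i) s) p)"
  define X where "X = (\<Sum>i\<in>UNIV. D (E i) \<eta> p * D (E i) s p)"
  have "(\<Sum>i\<in>UNIV. D (E i) (D (E i) \<eta>) p * \<sigma> + 2 * (D (E i) \<eta> p * D (E i) s p) + \<eta> p * D (E i) (D (E i) s) p
      + \<eta> p * \<sigma> * (2 * (\<Sum>\<alpha>\<in>UNIV. (D v (D (E i) (w \<alpha>)) p)\<^sup>2)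
          + (\<Sum>j\<in>UNIV. (D (E i) (D (E j) (height \<xi>)) p)\<^sup>2))) \<le> 0"
    by (rule sum_nonpos) (rule D2Z)
  then have sum2: "L\<eta> * \<sigma> + 2 * X + \<eta> p * Ls + \<eta> p * \<sigma> * (2 * T + N) \<le> 0"
    by (simp only: sum.distrib sum_distrib_left[symmetric] sum_distrib_right[symmetric]
        L\<eta>_def Ls_def X_def T_def N_def)
  have X: "\<eta> p * X = - \<sigma> * Q"
  proof -
    have "\<eta> p * X = (\<Sum>i\<in>UNIV. D (E i) \<eta> p * (\<eta> p * D (E i) s p))"
      by (simp add: X_def sum_distrib_left mult_ac)
    also have "\<dots> = (\<Sum>i\<in>UNIV. - \<sigma> * (D (E i) \<eta> p)\<^sup>2)"
    proof (rule sum.cong[OF refl])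
      fix i
      have "\<eta> p * D (E i) s p = - (D (E i) \<eta> p * \<sigma>)" using D1Z[of "E i"] by linarith
      then show "D (E i) \<eta> p * (\<eta> p * D (E i) s p) = - \<sigma> * (D (E i) \<eta> p)\<^sup>2"
        by (simp only: power2_eq_square) simp
    qed
    finally show ?thesis by (simp add: Q_def sum_distrib_left)
  qed
  \<comment> \<open>Maximality among directions enters here.  The negative term is exactly compensated by the
    term \<open>2 T\<close> that the length of \<open>v\<close> contributes to \<open>sum2\<close>.\<close>
  have Ls: "Ls + D A s p \<ge> - 2 * (\<sigma> * T)"
  proof -
    have "(\<Sum>\<alpha>\<in>UNIV. \<Sum>i\<in>UNIV. (D v (D (E i) (w \<alpha>)) p)\<^sup>2) = T"
      unfolding T_def by (rule sum.swap)
    then show ?thesis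
      using laplacian_second_derivative[of v \<xi>] gradient_trace_bound[OF dir, of v]
      by (simp only: Ls_def s_def)
  qed
  have N: "\<sigma>\<^sup>2 \<le> N" using hessian_square_bound[OF v, of \<xi>] by (simp add: N_def \<sigma>)
  have "\<eta> p * (L\<eta> * \<sigma> + 2 * X + \<eta> p * Ls + \<eta> p * \<sigma> * (2 * T + N)) \<le> 0"
    using sum2 eta(2) by (simp add: mult_nonneg_nonpos)
  moreover have "\<eta> p * (\<eta> p * Ls) \<ge> \<eta> p * (\<eta> p * (- 2 * (\<sigma> * T) - D A s p))"
    using Ls eta(2) by (intro mult_left_mono) auto
  moreover have "\<eta> p * (\<eta> p * \<sigma> * N) \<ge> \<eta> p * (\<eta> p * \<sigma> * \<sigma>\<^sup>2)"
    using N eta(2) \<sigma>(2) by (intro mult_left_mono) auto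
  moreover have "\<eta> p * (\<eta> p * D A s p) = \<eta> p * (- (D A \<eta> p * \<sigma>))"
    using D1Z[of A] by (simp add: add_eq_0_iff)
  ultimately have "\<sigma> * (\<eta> p * (L\<eta> + D A \<eta> p) - 2 * Q + (\<eta> p * \<sigma>)\<^sup>2) \<le> 0"
    using X by (simp add: algebra_simps power2_eq_square)
  then have "\<eta> p * (L\<eta> + D A \<eta> p) - 2 * Q + (\<eta> p * \<sigma>)\<^sup>2 \<le> 0"
    using \<sigma>(2) by (simp add: mult_le_0_iff)
  then show ?thesis by (simp add: L\<eta>_def Q_def)
qed

end

section \<open>Linear isometries of pseudo-Euclidean space\<close>

text \<open>Gram--Schmidt orthogonalisation.\<close>

lemma orthonormal_frame_exists:
  fixes q :: "'a::euclidean_space \<Rightarrow> 'a \<Rightarrow> real"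
  assumes bil: "bilinear q" and sym: "\<And>v w. q v w = q w v" and pos: "\<And>v. v \<noteq> 0 \<Longrightarrow> 0 < q v v"
  obtains T :: "'a \<Rightarrow> 'a" where "linear T" "\<And>v w. q (T v) (T w) = v \<bullet> w"
proof -
  have "\<exists>b. \<forall>i\<in>I. \<forall>j\<in>I. q (b i) (b j) = (if i = j then 1 else 0)"
    if "finite I" "I \<subseteq> Basis" for I :: "'a set"
    using that
  proof (induction I rule: finite_induct)
    case (insert k I)
    then obtain b where b: "\<And>i j. i \<in> I \<Longrightarrow> j \<in> I \<Longrightarrow> q (b i) (b j) = (if i = j then 1 else 0)"
      by (meson insert_subset)
    have "dim (b ` I) \<le> card (b ` I)" using insert.hyps by (intro dim_le_card') auto
    also have "\<dots> \<le> card I" using insert.hyps by (intro card_image_le)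
    also have "\<dots> < card (Basis :: 'a set)"
      using insert by (intro psubset_card_mono) auto
    finally have "dim (b ` I) < DIM('a)" .
    then have "span (b ` I) \<noteq> UNIV" by (metis dim_UNIV dim_span less_irrefl)
    then obtain v where v: "v \<notin> span (b ` I)" by blast
    define v' where "v' = v - (\<Sum>i\<in>I. q v (b i) *\<^sub>R b i)"
    have "(\<Sum>i\<in>I. q v (b i) *\<^sub>R b i) \<in> span (b ` I)"
      by (intro span_sum span_scale span_base) auto
    then have "v' \<noteq> 0" using v by (auto simp: v'_def)
    then have v'pos: "0 < q v' v'" by (rule pos)
    have orth: "q v' (b j) = 0" if "j \<in> I" for j
    proof -
      interpret linear "\<lambda>v. q v (b j)" using bil by (simp add: bilinear_def)
      have "q v' (b j) = q v (b j) - (\<Sum>i\<in>I. q v (b i) * q (b i) (b j))"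
        by (simp add: v'_def diff sum scale)
      also have "(\<Sum>i\<in>I. q v (b i) * q (b i) (b j)) = (\<Sum>i\<in>I. if i = j then q v (b j) else 0)"
        using that by (intro sum.cong) (auto simp: b)
      finally show ?thesis using that insert.hyps by simp
    qed
    define c where "c = b(k := (1 / sqrt (q v' v')) *\<^sub>R v')"
    have "q (c i) (c j) = (if i = j then 1 else 0)" if "i \<in> insert k I" "j \<in> insert k I" for i j
    proof -
      have "q (c k) (c k) = 1"
        using v'pos by (simp add: c_def bilinear_lmul[OF bil] bilinear_rmul[OF bil])
      moreover have "q (c k) (b j) = 0" if "j \<in> I" for j
        using orth[OF that] by (simp add: c_def bilinear_lmul[OF bil])
      moreover have "c i = b i" if "i \<in> I" for i using that insert.hyps by (auto simp: c_def)
      ultimately show ?thesis using that b insert.hyps sym by (metis insertE)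
    qed
    then show ?case by blast
  qed auto
  from this[OF finite_Basis subset_refl] obtain b :: "'a \<Rightarrow> 'a" where
    b: "\<And>i j. i \<in> Basis \<Longrightarrow> j \<in> Basis \<Longrightarrow> q (b i) (b j) = (if i = j then 1 else 0)" by blast
  define T where "T v = (\<Sum>i\<in>Basis. (v \<bullet> i) *\<^sub>R b i)" for v :: 'a
  have "linear T"
    by (rule linearI) (simp_all add: T_def inner_add_left scaleR_add_left sum.distrib scaleR_sum_right)
  moreover have "q (T v) (T w) = v \<bullet> w" for v w
  proof -
    have "q (T v) (T w) = (\<Sum>(i,j)\<in>Basis \<times> Basis. (v \<bullet> i) * ((w \<bullet> j) * q (b i) (b j)))"
      unfolding T_def
      by (subst bilinear_sum[OF bil])
        (simp add: bilinear_lmul[OF bil] bilinear_rmul[OF bil] case_prod_unfold mult.left_commute)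
    also have "\<dots> = (\<Sum>i\<in>Basis. \<Sum>j\<in>Basis. (v \<bullet> i) * ((w \<bullet> j) * q (b i) (b j)))"
      by (simp only: sum.cartesian_product)
    also have "\<dots> = (\<Sum>i\<in>Basis. \<Sum>j\<in>Basis. if i = j then (v \<bullet> i) * (w \<bullet> i) else 0)"
      by (intro sum.cong refl) (auto simp: b)
    also have "\<dots> = v \<bullet> w" by (simp add: euclidean_inner[of v w])
    finally show ?thesis .
  qed
  ultimately show ?thesis by (rule that)
qed

lemma pseudo_inner_nondegenerate:
  assumes "\<And>b. pseudo_inner a b = 0" shows "a = 0"
proof -
  have "pseudo_inner a (fst a, - snd a) = 0" by (rule assms)
  then have "fst a \<bullet> fst a + snd a \<bullet> snd a = 0" by (simp add: pseudo_inner_def)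
  then show ?thesis by (metis add_nonneg_eq_0_iff inner_eq_zero_iff inner_ge_zero prod_eq_iff zero_prod_def fst_conv snd_conv)
qed

lemma adjoint_of_contraction:
  fixes f :: "real^'m \<Rightarrow> real^'n"
  assumes f: "linear f" and contr: "\<And>v. v \<noteq> 0 \<Longrightarrow> norm (f v) < norm v" and w: "w \<noteq> 0"
  shows "norm (adjoint f w) < norm w"
proof (cases "adjoint f w = 0")
  case False
  let ?h = "adjoint f w"
  have "norm ?h * norm ?h = f ?h \<bullet> w"
    using adjoint_works[OF f, of ?h w] by (simp add: power2_norm_eq_inner[symmetric] power2_eq_square)
  also have "\<dots> \<le> norm (f ?h) * norm w" by (rule norm_cauchy_schwarz)
  also have "\<dots> < norm ?h * norm w" using contr[OF False] w by simp
  finally show ?thesis using False by simp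
qed (use w in simp)

text \<open>For a contraction \<open>f\<close> the graph of \<open>f\<close> is spacelike and the graph of its adjoint (over the vertical
  space) is its orthogonal complement.  Orthonormal bases of the two give an isometry from the
  standard splitting, whose inverse is the required map.\<close>

lemma boost_to_horizontal:
  fixes f :: "real^'m \<Rightarrow> real^'n"
  assumes f: "linear f" and contr: "\<And>v. v \<noteq> 0 \<Longrightarrow> norm (f v) < norm v"
  obtains \<Lambda> :: "(real^'m) \<times> (real^'n) \<Rightarrow> (real^'m) \<times> (real^'n)"
  where "linear \<Lambda>" "bij \<Lambda>" "\<And>a b. pseudo_inner (\<Lambda> a) (\<Lambda> b) = pseudo_inner a b"
    "\<And>v. snd (\<Lambda> (v, f v)) = 0"
proof -
  define h where "h = adjoint f"
  have h: "linear h" unfolding h_def by (rule adjoint_linear[OF f])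
  have adj: "v \<bullet> h w = f v \<bullet> w" "h w \<bullet> v = w \<bullet> f v" for v w
    using adjoint_works[OF f, of v w] adjoint_works[OF f, of v w]
    by (simp_all add: h_def inner_commute)
  note contr_h = adjoint_of_contraction[OF f contr, folded h_def]
  interpret f: linear f by (rule f)
  interpret h: linear h by (rule h)
  have sq: "a \<bullet> a < v \<bullet> v" if "norm a < norm v" for v :: "'x::real_inner" and a :: "'y::real_inner"
  proof -
    have "(norm a)\<^sup>2 < (norm v)\<^sup>2" using that by (intro power_strict_mono) auto
    then show ?thesis by (simp add: power2_norm_eq_inner)
  qed
  have "bilinear (\<lambda>v w. v \<bullet> w - f v \<bullet> f w)"
    by (auto simp: bilinear_def f.add f.scale algebra_simps intro!: linearI)
  from orthonormal_frame_exists[OF this] obtain T1 :: "real^'m \<Rightarrow> real^'m"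
    where T1: "linear T1" and T1q: "\<And>v w. T1 v \<bullet> T1 w - f (T1 v) \<bullet> f (T1 w) = v \<bullet> w"
    using sq[OF contr] by (auto simp: inner_commute)
  have "bilinear (\<lambda>v w. v \<bullet> w - h v \<bullet> h w)"
    by (auto simp: bilinear_def h.add h.scale algebra_simps intro!: linearI)
  from orthonormal_frame_exists[OF this] obtain T2 :: "real^'n \<Rightarrow> real^'n"
    where T2: "linear T2" and T2q: "\<And>v w. T2 v \<bullet> T2 w - h (T2 v) \<bullet> h (T2 w) = v \<bullet> w"
    using sq[OF contr_h] by (auto simp: inner_commute)
  interpret T1: linear T1 by (rule T1)
  interpret T2: linear T2 by (rule T2)
  define \<Theta> where "\<Theta> a = (T1 (fst a) + h (T2 (snd a)), f (T1 (fst a)) + T2 (snd a))"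
    for a :: "(real^'m) \<times> (real^'n)"
  have lin: "linear \<Theta>"
    by (rule linearI) (simp_all add: \<Theta>_def f.add f.scale h.add h.scale T1.add T1.scale T2.add T2.scale
        algebra_simps prod_eq_iff)
  have iso: "pseudo_inner (\<Theta> a) (\<Theta> b) = pseudo_inner a b" for a b
    using T1q[of "fst a" "fst b"] T2q[of "snd a" "snd b"]
    by (simp add: pseudo_inner_def \<Theta>_def inner_add_left inner_add_right adj f.add)
  have "inj \<Theta>"
  proof (subst linear_injective_0[OF lin], intro allI impI)
    fix a assume "\<Theta> a = 0"
    then have "pseudo_inner a b = 0" for b using iso[of a b] by (simp add: pseudo_inner_def)
    then show "a = 0" by (rule pseudo_inner_nondegenerate)
  qed
  then have bij: "bij \<Theta>" using linear_injective_imp_surjective[OF lin] by (simp add: bij_def)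
  have "inj T1"
  proof (subst linear_injective_0[OF T1], intro allI impI)
    fix v assume "T1 v = 0"
    then show "v = 0" using T1q[of v v] by (simp add: f.zero)
  qed
  then have surj: "surj T1" by (simp add: linear_injective_imp_surjective[OF T1])
  show ?thesis
  proof
    show "bij (inv \<Theta>)" by (rule bij_imp_bij_inv[OF bij])
    have inv: "\<Theta> (inv \<Theta> a) = a" for a using bij by (simp add: bij_def surj_f_inv_f)
    show "linear (inv \<Theta>)"
      using bij lin by (metis bij_def inj_linear_imp_inv_linear)
    show "pseudo_inner (inv \<Theta> a) (inv \<Theta> b) = pseudo_inner a b" for a b
      using iso[of "inv \<Theta> a" "inv \<Theta> b"] by (simp add: inv)
    show "snd (inv \<Theta> (v, f v)) = 0" for v
    proof -
      obtain y where "v = T1 y" using surj by blast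
      then have "\<Theta> (y, 0) = (v, f v)" by (simp add: \<Theta>_def T2.zero h.zero)
      then have "inv \<Theta> (v, f v) = (y, 0)" using bij by (metis bij_inv_eq_iff)
      then show ?thesis by simp
    qed
  qed
qed

lemma positive_definite_det: "positive_definite A \<Longrightarrow> det A \<noteq> 0"
  by (rule det_nonzero_if_kernel_trivial) (metis inner_zero_right less_irrefl positive_definite_def)

text \<open>With \<open>z = A\<^sup>-\<^sup>1 v\<close>, the lower bound for \<open>A\<close> and the Cauchy--Schwarz inequality give
  \<open>c |z|\<^sup>2 \<le> z \<bullet> v \<le> |z| |v|\<close>.\<close>

lemma inverse_matrix_bound:
  fixes A :: "real^'m^'m"
  assumes pd: "positive_definite A" and c: "0 < c" and lower: "\<And>v. c * (norm v)\<^sup>2 \<le> v \<bullet> (A *v v)"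
  shows "v \<bullet> (matrix_inv A *v v) \<le> (norm v)\<^sup>2 / c"
    "matrix_inv A $ k $ k \<le> 1 / c"
proof -
  have *: "v \<bullet> (matrix_inv A *v v) \<le> (norm v)\<^sup>2 / c" for v
  proof -
    define z where "z = matrix_inv A *v v"
    have Az: "A *v z = v"
      by (simp add: z_def matrix_vector_mul_assoc matrix_inv_cofactors[OF positive_definite_det[OF pd]])
    have "c * (norm z)\<^sup>2 \<le> z \<bullet> v" using lower[of z] by (simp add: Az)
    also have zv: "\<dots> \<le> norm z * norm v" by (rule norm_cauchy_schwarz)
    finally have "norm z * (c * norm z) \<le> norm z * norm v" by (simp add: power2_eq_square mult_ac)
    then have "norm z \<le> norm v / c"
      using c by (cases "z = 0") (auto simp: pos_le_divide_eq mult.commute)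
    then have "norm z * norm v \<le> norm v / c * norm v" by (rule mult_right_mono) simp
    with zv show ?thesis by (simp add: z_def[symmetric] inner_commute power2_eq_square)
  qed
  show "v \<bullet> (matrix_inv A *v v) \<le> (norm v)\<^sup>2 / c" by (rule *)
  have "axis k 1 \<bullet> (matrix_inv A *v axis k 1) = matrix_inv A $ k $ k"
    by (simp add: inner_axis' matrix_vector_mult_basis column_def)
  then show "matrix_inv A $ k $ k \<le> 1 / c" using *[of "axis k 1"] by (simp add: norm_axis_1)
qed

section \<open>Graphs that are translating solitons\<close>

lemma has_derivative_vec_lambda:
  assumes "\<And>\<alpha>. smooth (f \<alpha>)"
  shows "((\<lambda>x. \<chi> \<alpha>. f \<alpha> x) has_derivative (\<lambda>v. \<chi> \<alpha>. dird v (f \<alpha>) x)) (at x)"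
  by (subst has_derivative_componentwise_within)
    (auto simp: Basis_vec_def inner_axis smooth_has_derivative[OF assms])

lemma pseudo_inner_simps:
  "pseudo_inner (a + b) c = pseudo_inner a c + pseudo_inner b c"
  "pseudo_inner c (a + b) = pseudo_inner c a + pseudo_inner c b"
  "pseudo_inner (r *\<^sub>R a) c = r * pseudo_inner a c"
  "pseudo_inner c (r *\<^sub>R a) = r * pseudo_inner c a"
  by (simp_all add: pseudo_inner_def algebra_simps)

text \<open>The translation vector \<open>T\<close> is fixed here, so that its horizontal part can serve as the drift.\<close>

locale soliton_graph =
  fixes u :: "'n::finite \<Rightarrow> real^'m::finite \<Rightarrow> real" and T :: "(real^'m) \<times> (real^'n)"
  assumes smooth_u: "smooth (u \<alpha>)"
    and spacelike: "spacelike (graph_map u)"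
    and soliton: "mean_curvature_vector (graph_map u) x = normal_proj (graph_map u) x T"
begin

definition du :: "real^'m \<Rightarrow> real^'m \<Rightarrow> real^'n" where
  "du x v = (\<chi> \<alpha>. dird v (u \<alpha>) x)"

definition dX :: "real^'m \<Rightarrow> real^'m \<Rightarrow> (real^'m) \<times> (real^'n)" where
  "dX x v = (v, du x v)"

definition hess :: "real^'m \<Rightarrow> real^'m \<Rightarrow> real^'m \<Rightarrow> real^'n" where
  "hess x v w = (\<chi> \<alpha>. dird v (dird w (u \<alpha>)) x)"

definition g :: "real^'m \<Rightarrow> real^'m^'m" where
  "g x = induced_metric (graph_map u) x"

definition g_inv :: "real^'m \<Rightarrow> real^'m^'m" where
  "g_inv x = matrix_inv (g x)"

lemma has_derivative_graph: "(graph_map u has_derivative dX x) (at x)"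
  unfolding graph_map_def dX_def[abs_def] du_def
  by (intro has_derivative_Pair has_derivative_ident has_derivative_vec_lambda smooth_u)

lemma frechet_graph: "frechet_derivative (graph_map u) (at x) = dX x"
  by (rule frechet_derivative_at[OF has_derivative_graph, symmetric])

lemma linear_dX: "linear (dX x)"
  using has_derivative_graph has_derivative_linear by blast

lemma has_derivative_dX: "((\<lambda>x. dX x w) has_derivative (\<lambda>v. (0, hess x v w))) (at x)"
  unfolding dX_def du_def hess_def
  by (intro has_derivative_Pair has_derivative_const has_derivative_vec_lambda smooth_dird smooth_u)

lemma g_entry: "g x $ i $ j = pseudo_inner (dX x (axis i 1)) (dX x (axis j 1))"
  by (simp add: g_def induced_metric_def frechet_graph)

lemma g_quadratic: "v \<bullet> (g x *v w) = pseudo_inner (dX x v) (dX x w)"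
proof -
  interpret dX: linear "dX x" by (rule linear_dX)
  have l1: "linear (\<lambda>v. pseudo_inner (dX x v) (dX x w))" for w
    by (rule linearI) (simp_all add: dX.add dX.scale pseudo_inner_simps)
  have l2: "linear (\<lambda>w. pseudo_inner (dX x v) (dX x w))" for v
    by (rule linearI) (simp_all add: dX.add dX.scale pseudo_inner_simps)
  have "v \<bullet> (g x *v w) = (\<Sum>i\<in>UNIV. v $ i * (\<Sum>j\<in>UNIV. w $ j * pseudo_inner (dX x (axis i 1)) (dX x (axis j 1))))"
    by (simp add: inner_vec_def matrix_vector_mult_def g_entry mult.commute)
  also have "\<dots> = (\<Sum>i\<in>UNIV. v $ i * pseudo_inner (dX x (axis i 1)) (dX x w))"
    by (subst (2) linear_expand_axis[OF l2]) simp
  also have "\<dots> = pseudo_inner (dX x v) (dX x w)"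
    by (subst (2) linear_expand_axis[OF l1]) simp
  finally show ?thesis .
qed

lemma g_pd: "positive_definite (g x)"
  using spacelike by (simp add: spacelike_def g_def)

lemma g_pos: "v \<noteq> 0 \<Longrightarrow> 0 < v \<bullet> (g x *v v)"
  using g_pd by (simp add: positive_definite_def)

lemma g_explicit: "v \<bullet> (g x *v v) = (norm v)\<^sup>2 - (norm (du x v))\<^sup>2"
  by (simp add: g_quadratic pseudo_inner_def dX_def power2_norm_eq_inner)

lemma du_contracts: "v \<noteq> 0 \<Longrightarrow> norm (du x v) < norm v"
  using g_pos[of v x] by (simp add: g_explicit power2_less_imp_less)

lemma linear_du: "linear (du x)"
  using linear_compose[OF linear_dX linear_snd] by (simp add: o_def dX_def)

lemma smooth_g: "smooth (\<lambda>x. g x $ i $ j)"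
proof -
  have "(\<lambda>x. g x $ i $ j) = (\<lambda>x. axis i 1 \<bullet> (axis j 1 :: real^'m)
      - (\<Sum>\<alpha>\<in>UNIV. dird (axis i 1) (u \<alpha>) x * dird (axis j 1) (u \<alpha>) x))"
    by (rule ext) (simp add: g_entry pseudo_inner_def dX_def du_def inner_vec_def[where 'b='n])
  then show ?thesis by (simp only:) (intro smooth_intros smooth_u)
qed

lemma smooth_g_inv: "smooth (\<lambda>x. g_inv x $ i $ j)"
  unfolding g_inv_def by (rule smooth_matrix_inv[OF smooth_g positive_definite_det[OF g_pd]])

text \<open>All functions to which the operator is applied, except the cutoff, are linear functions of
  the position vector, in the original or in the boosted coordinates.\<close>

lemma linear_function_on_graph:
  fixes l :: "(real^'m) \<times> (real^'n) \<Rightarrow> real"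
  assumes l: "linear l"
  shows "dird v (\<lambda>x. l (graph_map u x)) x = l (dX x v)"
    and "dird v (\<lambda>x. l (dX x w)) x = l (0, hess x v w)"
    and "smooth (\<lambda>x. l (graph_map u x))"
proof -
  have bl: "bounded_linear l" using l by (simp add: linear_conv_bounded_linear)
  have d1: "((\<lambda>x. l (graph_map u x)) has_derivative (\<lambda>v. l (dX x v))) (at x)" for x
    by (rule bounded_linear.has_derivative[OF bl has_derivative_graph])
  have d2: "((\<lambda>x. l (dX x w)) has_derivative (\<lambda>v. l (0, hess x v w))) (at x)" for x w
    by (rule bounded_linear.has_derivative[OF bl has_derivative_dX])
  show 1: "dird v (\<lambda>x. l (graph_map u x)) x = l (dX x v)" for x v
    using frechet_derivative_at[OF d1] by metis
  show "dird v (\<lambda>x. l (dX x w)) x = l (0, hess x v w)"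
    using frechet_derivative_at[OF d2] by metis
  have "smooth (\<lambda>x. l (dX x v))" for v
  proof -
    interpret l: linear l by (rule l)
    have "l (dX x v) = l (v, 0) + (\<Sum>\<alpha>\<in>UNIV. dird v (u \<alpha>) x * l (0, axis \<alpha> 1))" for x
    proof -
      have "linear (\<lambda>z. l (0, z))"
        using linear_compose[OF _ l, of "\<lambda>z. (0, z)"] by (simp add: o_def linear_iff)
      from linear_expand_axis[OF this, of "du x v"]
      have "l (0, du x v) = (\<Sum>\<alpha>\<in>UNIV. dird v (u \<alpha>) x * l (0, axis \<alpha> 1))" by (simp add: du_def)
      moreover have "dX x v = (v, 0) + (0, du x v)" by (simp add: dX_def)
      ultimately show ?thesis by (simp only: l.add)
    qed
    then show ?thesis by (simp only:) (intro smooth_intros smooth_u)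
  qed
  then show "smooth (\<lambda>x. l (graph_map u x))"
    by (subst smooth_iff) (use d1 in \<open>auto simp: 1 differentiable_def\<close>)
qed

text \<open>The difference of the trace of the second derivatives of \<open>X\<close> and \<open>T\<close> has normal part
  \<open>H - T\<^sup>\<bottom> = 0\<close>, so it is tangent.  The second derivatives of a graph are vertical, and a tangent
  vector is determined by its horizontal part, here \<open>-a\<close>.\<close>

lemma soliton_equation:
  "(\<Sum>k\<in>UNIV. \<Sum>l\<in>UNIV. g_inv x $ k $ l *\<^sub>R (0, hess x (axis k 1) (axis l 1))) + dX x (fst T) = T"
proof -
  let ?N = "normal_proj (graph_map u) x" and ?H = "\<lambda>k l. (0 :: real^'m, hess x (axis k 1) (axis l 1))"
  interpret dX: linear "dX x" by (rule linear_dX)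
  have tan: "tangent_space (graph_map u) x = range (dX x)"
    by (simp add: tangent_space_def frechet_graph)
  have sub: "subspace (range (dX x))" by (rule linear_subspace_image[OF linear_dX subspace_UNIV])
  have proj: "V - ?N V \<in> range (dX x)" for V
  proof -
    have "graph_map u differentiable (at x)"
      using has_derivative_graph by (auto simp: differentiable_def)
    from theI'[OF normal_proj_ex1[OF this g_pd[unfolded g_def]]]
    show ?thesis by (simp add: normal_proj_def tan)
  qed
  have "(\<Sum>k\<in>UNIV. \<Sum>l\<in>UNIV. g_inv x $ k $ l *\<^sub>R ?N (?H k l)) = ?N T"
    using soliton[of x] frechet_derivative_at[OF has_derivative_dX, symmetric]
    by (simp add: mean_curvature_vector_def second_fundamental_form_def frechet_graph g_inv_def g_def)
  then have "(\<Sum>k\<in>UNIV. \<Sum>l\<in>UNIV. g_inv x $ k $ l *\<^sub>R ?H k l) - T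
      = (\<Sum>k\<in>UNIV. \<Sum>l\<in>UNIV. g_inv x $ k $ l *\<^sub>R (?H k l - ?N (?H k l))) - (T - ?N T)"
    by (simp add: scaleR_diff_right sum_subtractf del: diff_Pair scaleR_Pair)
  also have "\<dots> \<in> range (dX x)"
    by (intro subspace_diff[OF sub] subspace_sum[OF sub] subspace_scale[OF sub] proj)
  finally obtain c where c: "(\<Sum>k\<in>UNIV. \<Sum>l\<in>UNIV. g_inv x $ k $ l *\<^sub>R ?H k l) - T = dX x c" by auto
  have "fst ((\<Sum>k\<in>UNIV. \<Sum>l\<in>UNIV. g_inv x $ k $ l *\<^sub>R ?H k l) - T) = - fst T"
    by (simp add: fst_sum)
  then have "c = - fst T" unfolding c by (simp add: dX_def)
  then have "dX x c = - dX x (fst T)" by (simp add: dX.neg)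
  with c show ?thesis by (simp add: algebra_simps)
qed

lemma operator_on_linear_function:
  fixes l :: "(real^'m) \<times> (real^'n) \<Rightarrow> real"
  assumes l: "linear l"
  defines "f \<equiv> (\<lambda>x. l (graph_map u x))"
  shows "(\<Sum>i\<in>UNIV. \<Sum>j\<in>UNIV. g_inv x $ i $ j * dird (axis i 1) (dird (axis j 1) f) x) + dird (fst T) f x = l T"
proof -
  interpret l: linear l by (rule l)
  have "l T = l ((\<Sum>k\<in>UNIV. \<Sum>l\<in>UNIV. g_inv x $ k $ l *\<^sub>R (0, hess x (axis k 1) (axis l 1))) + dX x (fst T))"
    by (simp only: soliton_equation)
  then show ?thesis
    by (simp add: l.add l.sum l.scale f_def linear_function_on_graph[OF l] del: scaleR_Pair)
qed

end

section \<open>A graph seen after a linear isometry\<close>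

text \<open>The isometry \<open>\<Lambda>\<close> takes the tangent space at \<open>p\<close> to the horizontal space.\<close>

locale boosted_soliton_graph = soliton_graph u T
  for u :: "'n::finite \<Rightarrow> real^'m::finite \<Rightarrow> real" and T +
  fixes \<Lambda> :: "(real^'m) \<times> (real^'n) \<Rightarrow> (real^'m) \<times> (real^'n)" and p :: "real^'m"
  assumes linear_boost: "linear \<Lambda>" and bij_boost: "bij \<Lambda>"
    and isometry: "pseudo_inner (\<Lambda> a) (\<Lambda> b) = pseudo_inner a b"
    and horizontal: "snd (\<Lambda> (dX p v)) = 0"
begin

definition base :: "'m \<Rightarrow> real^'m \<Rightarrow> real" where
  "base j x = fst (\<Lambda> (graph_map u x)) $ j"

definition rise :: "'n \<Rightarrow> real^'m \<Rightarrow> real" where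
  "rise \<alpha> x = snd (\<Lambda> (graph_map u x)) $ \<alpha>"

lemma linear_components:
  "linear (\<lambda>a. fst (\<Lambda> a) $ j)" "linear (\<lambda>a. snd (\<Lambda> a) $ \<alpha>)"
proof -
  interpret linear \<Lambda> by (rule linear_boost)
  show "linear (\<lambda>a. fst (\<Lambda> a) $ j)" "linear (\<lambda>a. snd (\<Lambda> a) $ \<alpha>)"
    by (rule linearI; simp add: add scale)+
qed

lemma smooth_base: "smooth (base j)" and smooth_rise: "smooth (rise \<alpha>)"
  unfolding base_def[abs_def] rise_def[abs_def]
  by (rule linear_function_on_graph(3)[OF linear_components(1)],
      rule linear_function_on_graph(3)[OF linear_components(2)])

lemma dird_base: "dird v (base j) x = fst (\<Lambda> (dX x v)) $ j"
  and dird_rise: "dird v (rise \<alpha>) x = snd (\<Lambda> (dX x v)) $ \<alpha>"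
  unfolding base_def[abs_def] rise_def[abs_def]
  by (rule linear_function_on_graph(1)[OF linear_components(1)],
      rule linear_function_on_graph(1)[OF linear_components(2)])

lemma dird2_base: "dird v (dird w (base j)) x = fst (\<Lambda> (0, hess x v w)) $ j"
  and dird2_rise: "dird v (dird w (rise \<alpha>)) x = snd (\<Lambda> (0, hess x v w)) $ \<alpha>"
  unfolding dird_base dird_rise
  by (rule linear_function_on_graph(2)[OF linear_components(1)],
      rule linear_function_on_graph(2)[OF linear_components(2)])

text \<open>A nonzero tangent vector is spacelike, so its image under the isometry is not vertical.\<close>

sublocale moving_frame base
proof
  fix j show "smooth (base j)" by (rule smooth_base)
next
  fix v x assume z: "\<And>j. dird v (base j) x = 0"
  show "v = 0"
  proof (rule ccontr)
    assume "v \<noteq> 0"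
    then have "0 < pseudo_inner (\<Lambda> (dX x v)) (\<Lambda> (dX x v))"
      using g_pos[of v x] by (simp add: g_quadratic isometry)
    moreover have "fst (\<Lambda> (dX x v)) = 0" using z by (simp add: dird_base vec_eq_iff)
    ultimately show False by (simp add: pseudo_inner_def) (smt (verit) inner_ge_zero)
  qed
qed

lemma boost_dX: "\<Lambda> (dX x v) = (J x *v v, \<chi> \<alpha>. dird v (rise \<alpha>) x)"
  by (simp add: prod_eq_iff J_mult dird_base dird_rise vec_eq_iff)

lemma boost_dX_S: "\<Lambda> (dX x (S x *v v)) = (v, \<chi> \<alpha>. D v (rise \<alpha>) x)"
  by (simp add: boost_dX J_S_mult D_def)

definition frame_inverse_metric :: "'m \<Rightarrow> 'm \<Rightarrow> real^'m \<Rightarrow> real" where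
  "frame_inverse_metric i j x = (J x ** g_inv x ** transpose (J x)) $ i $ j"

lemma smooth_J: "smooth (\<lambda>x. J x $ i $ j)"
  by (simp add: J_def smooth_dird smooth_base)

text \<open>The leading coefficients are the inverse metric in the frame because \<open>S\<^sup>T g S\<close> is the metric in
  the frame, which the isometry expresses by the boosted heights.\<close>

sublocale soliton_frame base rise frame_inverse_metric "fst (\<Lambda> T)" "\<lambda>\<alpha>. snd (\<Lambda> T) $ \<alpha>" p
proof
  show "smooth (rise \<alpha>)" for \<alpha> by (rule smooth_rise)
  show "smooth (frame_inverse_metric i j)" for i j
    unfolding frame_inverse_metric_def[abs_def] matrix_matrix_mult_def transpose_def vec_lambda_beta
    by (intro smooth_sum smooth_mult smooth_J smooth_g_inv)
  show "D v (rise \<alpha>) p = 0" for v \<alpha>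
    by (simp add: D_def dird_rise horizontal)
  show "(\<Sum>i\<in>UNIV. \<Sum>j\<in>UNIV. frame_inverse_metric i j x * D (axis i 1) (D (axis j 1) (rise \<alpha>)) x) + D (fst (\<Lambda> T)) (rise \<alpha>) x
      = snd (\<Lambda> T) $ \<alpha>" for x \<alpha>
    unfolding frame_inverse_metric_def
    by (subst second_order_operator_in_frame[OF smooth_rise _ refl, symmetric, where a = "fst T"])
      (simp_all add: base_def[abs_def] rise_def[abs_def] operator_on_linear_function[OF linear_components(1)]
        operator_on_linear_function[OF linear_components(2)])
  show "(\<Sum>j\<in>UNIV. frame_inverse_metric i j x * ((if j = k then 1 else 0) -
      (\<Sum>\<alpha>\<in>UNIV. D (axis j 1) (rise \<alpha>) x * D (axis k 1) (rise \<alpha>) x))) = (if i = k then 1 else 0)" for i k x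
  proof -
    define M where "M = transpose (S x) ** g x ** S x"
    have M: "M $ j $ k = (if j = k then 1 else 0) - (\<Sum>\<alpha>\<in>UNIV. D (axis j 1) (rise \<alpha>) x * D (axis k 1) (rise \<alpha>) x)" for j k
    proof -
      have "M $ j $ k = axis j 1 \<bullet> (M *v axis k 1)"
        by (simp add: inner_axis' matrix_vector_mult_basis column_def)
      also have "\<dots> = (S x *v axis j 1) \<bullet> (g x *v (S x *v axis k 1))"
        by (simp only: M_def matrix_vector_mul_assoc[symmetric] transpose_matrix_vector
            inner_commute[of "axis j 1"] dot_lmul_matrix inner_commute[of "S x *v axis j 1"])
      also have "\<dots> = pseudo_inner (\<Lambda> (dX x (S x *v axis j 1))) (\<Lambda> (dX x (S x *v axis k 1)))"
        by (simp add: g_quadratic isometry)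
      also have "\<dots> = (if j = k then 1 else 0) - (\<Sum>\<alpha>\<in>UNIV. D (axis j 1) (rise \<alpha>) x * D (axis k 1) (rise \<alpha>) x)"
        by (simp add: boost_dX_S pseudo_inner_def inner_axis_axis) (simp add: inner_vec_def)
      finally show ?thesis .
    qed
    have "transpose (J x) ** transpose (S x) = mat 1"
      by (simp only: matrix_transpose_mul[symmetric] J_S transpose_mat)
    moreover have "(J x ** g_inv x ** transpose (J x)) ** M
        = J x ** (g_inv x ** (transpose (J x) ** transpose (S x)) ** g x) ** S x"
      by (simp only: M_def matrix_mul_assoc)
    ultimately have "(J x ** g_inv x ** transpose (J x)) ** M = mat 1"
      by (simp add: g_inv_def matrix_inv_cofactors[OF positive_definite_det[OF g_pd]] matrix_mul_rid J_S)
    then have "((J x ** g_inv x ** transpose (J x)) ** M) $ i $ k = (if i = k then 1 else 0)"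
      by (simp add: mat_def)
    then show ?thesis
      by (subst (asm) matrix_matrix_mult_def) (simp add: frame_inverse_metric_def M)
  qed
qed

end

section \<open>The estimate at a maximum of the weighted second fundamental form\<close>

lemma quadratic_cutoff:
  fixes x :: "real^'m" and R :: real
  defines "\<eta> \<equiv> \<lambda>x::real^'m. R\<^sup>2 - x \<bullet> x"
  shows "smooth \<eta>" "dird v \<eta> x = - 2 * (v \<bullet> x)" "dird v (dird w \<eta>) x = - 2 * (v \<bullet> w)"
proof -
  have "\<eta> = (\<lambda>x. R\<^sup>2 - (\<Sum>k\<in>UNIV. x $ k * x $ k))" by (simp add: \<eta>_def inner_vec_def)
  then show "smooth \<eta>" by (simp only:) (intro smooth_intros)
  have "(\<eta> has_derivative (\<lambda>v. - 2 * (v \<bullet> x))) (at x)" for x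
    unfolding \<eta>_def by (auto intro!: derivative_eq_intros simp: inner_commute)
  then have d: "dird v \<eta> x = - 2 * (v \<bullet> x)" for v x by (metis frechet_derivative_at)
  then show "dird v \<eta> x = - 2 * (v \<bullet> x)" .
  have "((\<lambda>x. - 2 * (w \<bullet> x)) has_derivative (\<lambda>v. - 2 * (w \<bullet> v))) (at x)"
    by (auto intro!: derivative_eq_intros)
  then have "dird v (\<lambda>x. - 2 * (w \<bullet> x)) x = - 2 * (w \<bullet> v)" by (metis frechet_derivative_at)
  then show "dird v (dird w \<eta>) x = - 2 * (v \<bullet> w)" by (simp only: d inner_commute)
qed

context soliton_graph begin

text \<open>The negative of the square of the normal vector with vertical part \<open>\<zeta>\<close>: normal vectors are
  determined by their vertical part, and the horizontal part has the components \<open>\<zeta> \<bullet> \<partial>\<^sub>k u\<close>.\<close>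

definition conormal_square :: "real^'m \<Rightarrow> real^'n \<Rightarrow> real" where
  "conormal_square x \<zeta> = (norm \<zeta>)\<^sup>2 - (\<Sum>k\<in>UNIV. (\<zeta> \<bullet> du x (axis k 1))\<^sup>2)"

lemma g_nonneg: "0 \<le> v \<bullet> (g x *v v)"
  using g_pos[of v x] by (cases "v = 0") (auto intro: less_imp_le)

text \<open>The horizontal part of the normal vector is the adjoint of \<open>du\<close> applied to \<open>\<zeta>\<close>, and \<open>du\<close> is a
  contraction.\<close>

lemma conormal_square_pos:
  assumes "\<zeta> \<noteq> 0" shows "0 < conormal_square x \<zeta>"
proof -
  have "(\<Sum>k\<in>UNIV. (\<zeta> \<bullet> du x (axis k 1))\<^sup>2) = (norm (adjoint (du x) \<zeta>))\<^sup>2"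
  proof -
    have "adjoint (du x) \<zeta> $ k = \<zeta> \<bullet> du x (axis k 1)" for k
      using adjoint_works[OF linear_du, of "axis k 1" x \<zeta>] by (simp add: inner_axis' inner_commute)
    then show ?thesis
      by (simp only: power2_norm_eq_inner inner_vec_def[where 'b='m]) (simp add: power2_eq_square)
  qed
  moreover have "(norm (adjoint (du x) \<zeta>))\<^sup>2 < (norm \<zeta>)\<^sup>2"
    using adjoint_of_contraction[OF linear_du du_contracts assms] by (intro power_strict_mono) auto
  ultimately show ?thesis by (simp add: conormal_square_def)
qed

end

context boosted_soliton_graph begin

lemma metric_in_frame:
  "(S x *v v) \<bullet> (g x *v (S x *v v)) = (norm v)\<^sup>2 - (\<Sum>\<alpha>\<in>UNIV. D v (rise \<alpha>) x * D v (rise \<alpha>) x)"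
proof -
  have "(S x *v v) \<bullet> (g x *v (S x *v v)) = pseudo_inner (\<Lambda> (dX x (S x *v v))) (\<Lambda> (dX x (S x *v v)))"
    by (simp add: g_quadratic isometry)
  then show ?thesis
    by (simp add: boost_dX_S pseudo_inner_def power2_norm_eq_inner) (simp add: inner_vec_def)
qed

text \<open>The normal vector whose vertical part is \<open>\<xi>\<close> in the boosted splitting.\<close>

definition normal_lift :: "real^'m \<Rightarrow> real^'n \<Rightarrow> (real^'m) \<times> (real^'n)" where
  "normal_lift x \<xi> = inv \<Lambda> (\<chi> j. D (E j) (height \<xi>) x, \<xi>)"

lemma boost_normal_lift: "\<Lambda> (normal_lift x \<xi>) = (\<chi> j. D (E j) (height \<xi>) x, \<xi>)"
  using bij_boost by (simp add: normal_lift_def bij_def surj_f_inv_f)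

lemma normal_lift_normal: "pseudo_inner (dX x c) (normal_lift x \<xi>) = 0"
proof -
  have "pseudo_inner (dX x c) (normal_lift x \<xi>) = pseudo_inner (\<Lambda> (dX x c)) (\<Lambda> (normal_lift x \<xi>))"
    by (simp only: isometry)
  also have "\<dots> = (\<Sum>j\<in>UNIV. (J x *v c) $ j * D (E j) (height \<xi>) x) - (\<Sum>\<alpha>\<in>UNIV. dird c (rise \<alpha>) x * \<xi> $ \<alpha>)"
    by (simp add: boost_normal_lift boost_dX pseudo_inner_def) (simp add: inner_vec_def)
  also have "\<dots> = D (J x *v c) (height \<xi>) x - (\<Sum>\<alpha>\<in>UNIV. \<xi> $ \<alpha> * D (J x *v c) (rise \<alpha>) x)"
    by (subst D_expand[OF smooth_height, of "J x *v c"]) (simp add: dird_D[of "rise _"] mult.commute)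
  finally show ?thesis by (simp add: D_height)
qed

lemma fst_normal_lift: "fst (normal_lift x \<xi>) $ k = snd (normal_lift x \<xi>) \<bullet> du x (axis k 1)"
  using normal_lift_normal[of x "axis k 1" \<xi>]
  by (simp add: pseudo_inner_def dX_def inner_axis' inner_commute)

lemma conormal_square_in_frame: "conormal_square x (snd (normal_lift x \<xi>)) = (norm \<xi>)\<^sup>2 - (\<Sum>j\<in>UNIV. (D (E j) (height \<xi>) x)\<^sup>2)"
proof -
  let ?\<nu> = "normal_lift x \<xi>"
  have "- conormal_square x (snd ?\<nu>) = pseudo_inner ?\<nu> ?\<nu>"
    by (simp add: pseudo_inner_def conormal_square_def power2_norm_eq_inner)
      (simp add: inner_vec_def[of "fst _"] fst_normal_lift power2_eq_square)
  also have "\<dots> = pseudo_inner (\<Lambda> ?\<nu>) (\<Lambda> ?\<nu>)" by (simp only: isometry)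
  also have "\<dots> = (\<Sum>j\<in>UNIV. (D (E j) (height \<xi>) x)\<^sup>2) - (norm \<xi>)\<^sup>2"
    by (simp add: boost_normal_lift pseudo_inner_def power2_norm_eq_inner)
      (simp add: inner_vec_def power2_eq_square)
  finally show ?thesis by simp
qed

text \<open>Both sides are the second fundamental form in the direction of the normal vector.  The second
  derivatives of the position vector along the frame differ from \<open>(0, D\<^sup>2u)\<close> by a tangent vector, and
  after the boost their horizontal part vanishes.\<close>

lemma hessian_in_frame:
  "D v (D v (height \<xi>)) x = snd (normal_lift x \<xi>) \<bullet> hess x (S x *v v) (S x *v v)"
proof -
  let ?\<nu> = "normal_lift x \<xi>" and ?s = "S x *v v"
  obtain c where c: "\<And>f. smooth f \<Longrightarrow> D v (D v f) x = dird ?s (dird ?s f) x + dird c f x"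
    using D_D_expand by blast
  define W where "W = (0, hess x ?s ?s) + dX x c"
  interpret boost: linear \<Lambda> by (rule linear_boost)
  have "fst (\<Lambda> W) $ j = 0" for j
    using c[OF smooth_base, of j] by (simp add: W_def boost.add dird2_base dird_base[where v=c])
  then have "fst (\<Lambda> W) = 0" by (simp add: vec_eq_iff)
  moreover have "snd (\<Lambda> W) $ \<alpha> = D v (D v (rise \<alpha>)) x" for \<alpha>
    using c[OF smooth_rise, of \<alpha>] by (simp add: W_def boost.add dird2_rise dird_rise[where v=c])
  ultimately have "pseudo_inner (\<Lambda> W) (\<Lambda> ?\<nu>) = - D v (D v (height \<xi>)) x"
    by (simp add: boost_normal_lift pseudo_inner_def D_D_height) (simp add: inner_vec_def mult.commute)
  moreover have "pseudo_inner (\<Lambda> W) (\<Lambda> ?\<nu>) = - (snd ?\<nu> \<bullet> hess x ?s ?s)"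
    unfolding isometry W_def pseudo_inner_simps normal_lift_normal
    by (simp add: pseudo_inner_def inner_commute)
  ultimately show ?thesis by simp
qed

text \<open>At \<open>p\<close> the boost takes the normal space to the vertical space.\<close>

lemma normal_lift_onto:
  "\<exists>\<xi>. snd (normal_lift p \<xi>) = \<zeta>"
proof -
  define \<nu> where "\<nu> = (\<chi> k. \<zeta> \<bullet> du p (axis k 1), \<zeta>)"
  have "linear (\<lambda>c. \<zeta> \<bullet> du p c)"
    using linear_du[of p] by (simp add: linear_iff inner_add_right)
  note expand = linear_expand_axis[OF this]
  have "pseudo_inner (dX p c) \<nu> = 0" for c
  proof -
    have "pseudo_inner (dX p c) \<nu> = (\<Sum>k\<in>UNIV. c $ k * (\<zeta> \<bullet> du p (axis k 1))) - \<zeta> \<bullet> du p c"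
      by (simp add: \<nu>_def pseudo_inner_def dX_def inner_commute[of "du p c"]) (simp add: inner_vec_def[of c])
    then show ?thesis using expand[of c] by simp
  qed
  then have "pseudo_inner (\<Lambda> (dX p c)) (\<Lambda> \<nu>) = 0" for c by (simp only: isometry)
  moreover have "pseudo_inner (\<Lambda> (dX p c)) (\<Lambda> \<nu>) = (J p *v c) \<bullet> fst (\<Lambda> \<nu>)" for c
    unfolding pseudo_inner_def horizontal by (simp add: boost_dX)
  ultimately have "(J p *v c) \<bullet> fst (\<Lambda> \<nu>) = 0" for c by simp
  from this[of "S p *v fst (\<Lambda> \<nu>)"] have "fst (\<Lambda> \<nu>) = 0" by (simp add: J_S_mult)
  then have "(\<chi> j. D (E j) (height (snd (\<Lambda> \<nu>))) p, snd (\<Lambda> \<nu>)) = \<Lambda> \<nu>"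
    by (simp add: prod_eq_iff D_height critical vec_eq_iff)
  then have "normal_lift p (snd (\<Lambda> \<nu>)) = \<nu>"
    using bij_boost by (simp add: normal_lift_def bij_def inv_f_f)
  then have "snd (normal_lift p (snd (\<Lambda> \<nu>))) = \<zeta>" by (simp add: \<nu>_def)
  then show ?thesis ..
qed

lemma gradient_square_in_frame:
  assumes "smooth f"
  shows "(\<Sum>i\<in>UNIV. (D (E i) f p)\<^sup>2)
    = (\<chi> k. dird (axis k 1) f p) \<bullet> (g_inv p *v (\<chi> k. dird (axis k 1) f p))"
proof -
  define d where "d = (\<chi> i. D (E i) f p)"
  have "J p ** g_inv p ** transpose (J p) = mat 1"
    using G_p by (simp add: frame_inverse_metric_def vec_eq_iff mat_def)
  then have "d \<bullet> d = d \<bullet> ((J p ** g_inv p ** transpose (J p)) *v d)" by simp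
  also have "\<dots> = (transpose (J p) *v d) \<bullet> (g_inv p *v (transpose (J p) *v d))"
    by (simp only: matrix_vector_mul_assoc[symmetric] transpose_matrix_vector dot_lmul_matrix)
  also have "transpose (J p) *v d = (\<chi> k. dird (axis k 1) f p)"
  proof -
    have "dird (axis k 1) f p = (\<Sum>i\<in>UNIV. J p $ i $ k * D (E i) f p)" for k
      using D_expand[OF assms, of "J p *v axis k 1" p] dird_D[of f p "axis k 1"]
      by (simp add: matrix_vector_mult_basis column_def)
    then show ?thesis by (simp add: vec_eq_iff matrix_vector_mult_def transpose_def d_def)
  qed
  finally show ?thesis by (simp add: d_def inner_vec_def power2_eq_square)
qed

text \<open>The maximum inequality for the cutoff \<open>R\<^sup>2 - |x|\<^sup>2\<close>, expressed by the original data: the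
  squared gradient of the cutoff is \<open>4 g\<^sup>-\<^sup>1(x, x)\<close> and the operator takes it to
  \<open>- 2 tr g\<^sup>-\<^sup>1 - 2 a \<bullet> x\<close>.\<close>

lemma maximum_estimate:
  fixes R c\<^sub>0 :: real
  defines "\<eta> \<equiv> \<lambda>x::real^'m. R\<^sup>2 - x \<bullet> x"
  assumes p: "norm p < R" and c: "0 < c\<^sub>0"
    and v0: "v\<^sub>0 \<bullet> (g p *v v\<^sub>0) = 1" and z0: "conormal_square p \<zeta>\<^sub>0 = 1"
    and attained: "\<eta> p * (\<zeta>\<^sub>0 \<bullet> hess p v\<^sub>0 v\<^sub>0) = c\<^sub>0"
    and bound: "\<And>x v \<zeta>. norm x \<le> R \<Longrightarrow>
      \<eta> x * (\<zeta> \<bullet> hess x v v) \<le> c\<^sub>0 * ((v \<bullet> (g x *v v)) * sqrt (conormal_square x \<zeta>))"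
  shows "c\<^sub>0\<^sup>2 \<le> 8 * (p \<bullet> (g_inv p *v p)) + 2 * \<eta> p * ((\<Sum>k\<in>UNIV. g_inv p $ k $ k) + fst T \<bullet> p)"
proof -
  have smeta: "smooth \<eta>" unfolding \<eta>_def by (rule quadratic_cutoff)
  have "(norm p)\<^sup>2 < R\<^sup>2" using p by (intro power_strict_mono) auto
  then have eta_p: "0 < \<eta> p" by (simp add: \<eta>_def power2_norm_eq_inner)
  define v where "v = J p *v v\<^sub>0"
  have Sv: "S p *v v = v\<^sub>0" by (simp add: v_def J_S_mult)
  have "(norm v)\<^sup>2 = 1" using metric_in_frame[of p v] v0 by (simp add: Sv critical)
  then have v: "norm v = 1" using norm_ge_zero[of v] by (auto simp: power2_eq_1_iff)
  obtain \<xi> where \<xi>: "snd (normal_lift p \<xi>) = \<zeta>\<^sub>0" using normal_lift_onto by blast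
  have height_p: "D w (height \<xi>) p = 0" for w by (simp add: D_height critical)
  have \<xi>1: "(norm \<xi>)\<^sup>2 = 1" using conormal_square_in_frame[of p \<xi>] z0 by (simp add: \<xi> height_p)
  define \<sigma> where "\<sigma> = D v (D v (height \<xi>)) p"
  have c0: "c\<^sub>0 = \<eta> p * \<sigma>" using attained by (simp add: \<sigma>_def hessian_in_frame Sv \<xi>)
  then have \<sigma>: "0 < \<sigma>" using c eta_p by (simp add: zero_less_mult_iff)
  have frame_bound: "\<eta> x * D z (D z (height \<xi>)) x \<le> c\<^sub>0 *
      (((norm z)\<^sup>2 - (\<Sum>\<alpha>\<in>UNIV. D z (rise \<alpha>) x * D z (rise \<alpha>) x)) * sqrt (1 - (\<Sum>j\<in>UNIV. (D (E j) (height \<xi>) x)\<^sup>2)))"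
    if "norm x \<le> R" for x z
    using bound[OF that, of "snd (normal_lift x \<xi>)" "S x *v z"]
    by (simp only: hessian_in_frame[symmetric] metric_in_frame conormal_square_in_frame \<xi>1)
  have dir: "D z (D z (height \<xi>)) p \<le> \<sigma> * (norm z)\<^sup>2" for z
  proof -
    have "\<eta> p * D z (D z (height \<xi>)) p \<le> \<eta> p * (\<sigma> * (norm z)\<^sup>2)"
      using frame_bound[of p z] p by (simp add: critical height_p c0 mult.assoc)
    then show ?thesis using eta_p by simp
  qed
  have key: "(\<eta> p * \<sigma>)\<^sup>2 \<le> 2 * (\<Sum>i\<in>UNIV. (D (E i) \<eta> p)\<^sup>2)
      - \<eta> p * ((\<Sum>i\<in>UNIV. D (E i) (D (E i) \<eta>) p) + D (fst (\<Lambda> T)) \<eta> p)"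
  proof (rule weighted_maximum_inequality[OF smeta eta_p v \<sigma>_def \<sigma> dir, where r = "R - norm p"])
    show "0 < R - norm p" using p by simp
    fix x assume "x \<in> ball p (R - norm p)"
    then have x: "norm x \<le> R" using norm_triangle_ineq2[of x p] by (simp add: dist_norm norm_minus_commute)
    let ?Q = "\<Sum>j\<in>UNIV. (D (E j) (height \<xi>) x)\<^sup>2"
    let ?g = "1 - (\<Sum>\<alpha>\<in>UNIV. D v (rise \<alpha>) x * D v (rise \<alpha>) x)"
    have "normal_lift x \<xi> \<noteq> 0"
    proof
      assume "normal_lift x \<xi> = 0"
      then have "\<Lambda> (normal_lift x \<xi>) = 0" by (simp add: linear_0[OF linear_boost])
      then have "\<xi> = 0" unfolding boost_normal_lift by (simp add: zero_prod_def)
      then show False using \<xi>1 by simp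
    qed
    moreover have "fst (normal_lift x \<xi>) = 0" if "snd (normal_lift x \<xi>) = 0"
      by (simp only: vec_eq_iff fst_normal_lift that) simp
    ultimately have "snd (normal_lift x \<xi>) \<noteq> 0" by (auto simp: prod_eq_iff)
    from conormal_square_pos[OF this, of x] have "0 < 1 - ?Q" by (simp only: conormal_square_in_frame \<xi>1)
    then have "sqrt (1 - ?Q) \<le> 1 - ?Q / 2"
      using arith_geo_mean_sqrt[of 1 "1 - ?Q"] by simp
    moreover have "0 \<le> ?g"
      using metric_in_frame[of x v] v g_nonneg[of "S x *v v" x] by simp
    ultimately have "c\<^sub>0 * (?g * sqrt (1 - ?Q)) \<le> c\<^sub>0 * (?g * (1 - ?Q / 2))"
      using c by (intro mult_left_mono) auto
    moreover have "?Q / 2 = (\<Sum>j\<in>UNIV. 1/2 * D (E j) (height \<xi>) x * D (E j) (height \<xi>) x)"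
      by (simp add: sum_divide_distrib power2_eq_square)
    ultimately show "\<eta> x * D v (D v (height \<xi>)) x \<le> \<eta> p * \<sigma> *
        (?g * (1 - (\<Sum>j\<in>UNIV. 1/2 * D (E j) (height \<xi>) x * D (E j) (height \<xi>) x)))"
      using frame_bound[OF x, of v] v by (simp add: c0)
  qed
  have gradient: "(\<Sum>i\<in>UNIV. (D (E i) \<eta> p)\<^sup>2) = 4 * (p \<bullet> (g_inv p *v p))"
  proof -
    have "(\<chi> k. dird (axis k 1) \<eta> p) = (- 2) *\<^sub>R p"
      by (simp add: vec_eq_iff \<eta>_def quadratic_cutoff(2) inner_axis')
    then show ?thesis
      by (simp only: gradient_square_in_frame[OF smeta] matrix_vector_mult_scaleR
          inner_scaleR_left inner_scaleR_right)
  qed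
  have laplacian: "(\<Sum>i\<in>UNIV. D (E i) (D (E i) \<eta>) p) + D (fst (\<Lambda> T)) \<eta> p
      = - 2 * ((\<Sum>k\<in>UNIV. g_inv p $ k $ k) + fst T \<bullet> p)"
  proof -
    have "(\<Sum>i\<in>UNIV. D (E i) (D (E i) \<eta>) p) = (\<Sum>i\<in>UNIV. \<Sum>j\<in>UNIV. frame_inverse_metric i j p * D (E i) (D (E j) \<eta>) p)"
    proof -
      have "frame_inverse_metric i j p = (if j = i then 1 else 0)" for i j by (auto simp: G_p)
      then show ?thesis by (simp only: mult.commute[of "if _ then _ else _"] sum_delta_right)
    qed
    moreover have "(\<Sum>i\<in>UNIV. \<Sum>j\<in>UNIV. frame_inverse_metric i j p * D (E i) (D (E j) \<eta>) p) + D (fst (\<Lambda> T)) \<eta> p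
        = (\<Sum>k\<in>UNIV. \<Sum>l\<in>UNIV. g_inv p $ k $ l * dird (axis k 1) (dird (axis l 1) \<eta>) p) + dird (fst T) \<eta> p"
      unfolding frame_inverse_metric_def
      by (rule second_order_operator_in_frame[OF smeta _ refl, symmetric])
        (simp add: base_def[abs_def] operator_on_linear_function[OF linear_components(1)])
    moreover have "(\<Sum>k\<in>UNIV. \<Sum>l\<in>UNIV. g_inv p $ k $ l * dird (axis k 1) (dird (axis l 1) \<eta>) p)
        + dird (fst T) \<eta> p = - 2 * ((\<Sum>k\<in>UNIV. g_inv p $ k $ k) + fst T \<bullet> p)"
    proof -
      have "dird (axis k 1) (dird (axis l 1) \<eta>) p = (- 2) * (if l = k then 1 else 0)" for k l
        unfolding \<eta>_def quadratic_cutoff(3) by (simp add: inner_axis_axis)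
      then have "(\<Sum>k\<in>UNIV. \<Sum>l\<in>UNIV. g_inv p $ k $ l * dird (axis k 1) (dird (axis l 1) \<eta>) p)
          = (\<Sum>k\<in>UNIV. \<Sum>l\<in>UNIV. (g_inv p $ k $ l * (- 2)) * (if l = k then 1 else 0))"
        by (simp only: mult.assoc)
      also have "\<dots> = - 2 * (\<Sum>k\<in>UNIV. g_inv p $ k $ k)"
        by (simp only: sum_delta_right sum_distrib_left mult.commute[of "- 2 :: real"])
      finally show ?thesis by (simp add: \<eta>_def quadratic_cutoff(2))
    qed
    ultimately show ?thesis by (simp only:)
  qed
  show ?thesis using key unfolding gradient laplacian c0 by (simp add: algebra_simps)
qed

end

section \<open>Vanishing of the second fundamental form\<close>

text \<open>The derivative along a ray from the origin is constant.\<close>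

lemma affine_if_second_derivatives_vanish:
  fixes f :: "real^'m \<Rightarrow> real"
  assumes f: "smooth f" and zero: "\<And>x v. dird v (dird v f) x = 0"
  shows "f x = (\<chi> k. dird (axis k 1) f 0) \<bullet> x + f 0"
proof -
  have "\<forall>t. ((\<lambda>t. dird x f (0 + t *\<^sub>R x)) has_real_derivative 0) (at t)"
    using smooth_line_deriv[OF smooth_dird[OF f, of x], of 0 x] by (simp add: zero)
  then have const: "dird x f (0 + t *\<^sub>R x) = dird x f (0 + 0 *\<^sub>R x)" for t
    by (rule DERIV_isconst_all)
  obtain s where "f (0 + 1 *\<^sub>R x) - f (0 + 0 *\<^sub>R x) = (1 - 0) * dird x f (0 + s *\<^sub>R x)"
    using MVT2[OF zero_less_one smooth_line_deriv[OF f, of 0 x]] by blast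
  then have "f x - f 0 = dird x f 0" using const[of s] by simp
  also have "\<dots> = (\<chi> k. dird (axis k 1) f 0) \<bullet> x"
    by (subst dird_expand[OF f]) (simp add: inner_vec_def mult.commute)
  finally show ?thesis by simp
qed

lemma graph_of_affine_functions:
  fixes u :: "'n::finite \<Rightarrow> real^'m::finite \<Rightarrow> real"
  assumes u: "\<And>\<alpha> x. u \<alpha> x = a \<alpha> \<bullet> x + c \<alpha>"
  shows "affine (range (graph_map u))" "aff_dim (range (graph_map u)) = int CARD('m)"
proof -
  define L :: "real^'m \<Rightarrow> (real^'m) \<times> (real^'n)" where "L x = (x, \<chi> \<alpha>. a \<alpha> \<bullet> x)" for x
  have lin: "linear L"
    by (rule linearI) (auto simp: L_def vec_eq_iff inner_add_right)
  have inj: "inj L" by (rule injI) (simp add: L_def)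
  have r: "range (graph_map u) = (+) (0, \<chi> \<alpha>. c \<alpha>) ` range L"
    by (auto simp: graph_map_def L_def u image_image vec_eq_iff add.commute intro!: image_eqI)
  have sub: "subspace (range L)" by (rule linear_subspace_image[OF lin subspace_UNIV])
  show "affine (range (graph_map u))"
    unfolding r using sub by (simp add: affine_translation[symmetric] subspace_imp_affine)
  have "aff_dim (range (graph_map u)) = int (dim (range L))"
    unfolding r using sub by (simp add: aff_dim_translation_eq aff_dim_subspace)
  also have "dim (range L) = dim (UNIV :: (real^'m) set)"
    by (rule dim_image_eq[OF lin]) (use inj in \<open>auto simp: inj_on_def inj_def\<close>)
  finally show "aff_dim (range (graph_map u)) = int CARD('m)" by simp
qed

context soliton_graph begin

lemma hess_expand:
  "hess x v w $ \<alpha> = (\<Sum>k\<in>UNIV. \<Sum>l\<in>UNIV. v $ k * w $ l * dird (axis k 1) (dird (axis l 1) (u \<alpha>)) x)"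
  unfolding hess_def by (subst dird2_expand[OF smooth_u]) simp

lemma hess_scale: "hess x (a *\<^sub>R v) (a *\<^sub>R v) = a\<^sup>2 *\<^sub>R hess x v v"
  by (simp add: vec_eq_iff hess_expand sum_distrib_left power2_eq_square mult_ac)

lemma conormal_square_scale: "conormal_square x (b *\<^sub>R \<zeta>) = b\<^sup>2 * conormal_square x \<zeta>"
  by (simp add: conormal_square_def power_mult_distrib sum_distrib_left right_diff_distrib)

lemma g_scale: "(a *\<^sub>R v) \<bullet> (g x *v (a *\<^sub>R v)) = a\<^sup>2 * (v \<bullet> (g x *v v))"
  by (simp add: matrix_vector_mult_scaleR power2_eq_square)

text \<open>The quotient is homogeneous of degree zero in \<open>v\<close> and \<open>\<zeta>\<close>, so the supremum is attained on a
  product of a ball and two spheres; there it is positive, which keeps the maximum point inside the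
  ball.\<close>

lemma maximizer_exists:
  fixes R :: real
  defines "\<eta> \<equiv> \<lambda>x::real^'m. R\<^sup>2 - x \<bullet> x"
  assumes x0: "norm x\<^sub>0 < R" and pos: "0 < \<zeta>\<^sub>0 \<bullet> hess x\<^sub>0 w w"
  obtains p v \<zeta> c where "norm p < R" "0 < c" "v \<bullet> (g p *v v) = 1" "conormal_square p \<zeta> = 1"
    "\<eta> p * (\<zeta> \<bullet> hess p v v) = c"
    "\<And>x v \<zeta>. norm x \<le> R \<Longrightarrow> \<eta> x * (\<zeta> \<bullet> hess x v v) \<le> c * ((v \<bullet> (g x *v v)) * sqrt (conormal_square x \<zeta>))"
proof -
  define N where "N x v \<zeta> = (v \<bullet> (g x *v v)) * sqrt (conormal_square x \<zeta>)" for x v \<zeta>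
  define q where "q x v \<zeta> = \<eta> x * (\<zeta> \<bullet> hess x v v)" for x v \<zeta>
  define \<Phi> where "\<Phi> = (\<lambda>(x, v, \<zeta>). q x v \<zeta> / N x v \<zeta>)"
  define A where "A = cball (0::real^'m) R \<times> sphere (0::real^'m) 1 \<times> sphere (0::real^'n) 1"
  have N_pos: "0 < N x v \<zeta>" if "v \<noteq> 0" "\<zeta> \<noteq> 0" for x v \<zeta>
    unfolding N_def using g_pos[OF that(1)] conormal_square_pos[OF that(2)] by simp
  have N_nonzero: "N x v \<zeta> \<noteq> 0" if "norm v = 1" "norm \<zeta> = 1" for x v \<zeta>
  proof -
    have "v \<noteq> 0" "\<zeta> \<noteq> 0" using that by auto
    then show ?thesis using N_pos[of v \<zeta> x] by simp
  qed
  have c_q: "continuous_on A (\<lambda>z. q (fst z) (fst (snd z)) (snd (snd z)))"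
    unfolding q_def \<eta>_def inner_vec_def[where 'b='n] hess_expand inner_real_def
    by (intro continuous_intros continuous_on_smooth_fst smooth_dird smooth_u)
  have c_N: "continuous_on A (\<lambda>z. N (fst z) (fst (snd z)) (snd (snd z)))"
    unfolding N_def conormal_square_def inner_vec_def[where 'b='n] inner_vec_def[where 'b='m]
      matrix_vector_mult_def du_def vec_lambda_beta inner_real_def
    by (intro continuous_intros continuous_on_smooth_fst smooth_dird smooth_u smooth_g)
  have "continuous_on A \<Phi>"
    unfolding \<Phi>_def case_prod_unfold using c_q c_N
    by (intro continuous_on_divide) (auto simp: A_def N_nonzero)
  moreover have "compact A" unfolding A_def by (intro compact_Times compact_cball compact_sphere)
  \<comment> \<open>Any unit vectors will do.\<close>
  moreover have "(x\<^sub>0, axis undefined 1, axis undefined 1) \<in> A"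
    using x0 by (simp add: A_def norm_axis_1)
  then have "A \<noteq> {}" by blast
  ultimately obtain z where "z \<in> A" and zmax: "\<And>y. y \<in> A \<Longrightarrow> \<Phi> y \<le> \<Phi> z"
    using continuous_attains_sup[of A \<Phi>] by blast
  obtain p v \<zeta> where z: "z = (p, v, \<zeta>)" by (rule prod_cases3)
  then have p: "norm p \<le> R" and "norm v = 1" "norm \<zeta> = 1" using \<open>z \<in> A\<close> by (auto simp: A_def)
  then have v: "v \<noteq> 0" and \<zeta>: "\<zeta> \<noteq> 0" by auto
  define c where "c = \<Phi> z"
  have scale: "q x (a *\<^sub>R v) (b *\<^sub>R \<zeta>) = (a\<^sup>2 * b) * q x v \<zeta>"
    "N x (a *\<^sub>R v) (b *\<^sub>R \<zeta>) = (a\<^sup>2 * b) * N x v \<zeta>" if "0 < b" for a b x v \<zeta>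
    unfolding q_def N_def hess_scale conormal_square_scale g_scale using that by (simp_all add: real_sqrt_mult)
  have bound: "q x v \<zeta> \<le> c * N x v \<zeta>" if x: "norm x \<le> R" for x v \<zeta>
  proof (cases "v = 0 \<or> \<zeta> = 0")
    case True
    then show ?thesis using hess_scale[of x 0 v] conormal_square_scale[of x 0 \<zeta>] by (auto simp: q_def N_def)
  next
    case False
    let ?a = "1 / norm v" and ?b = "1 / norm \<zeta>"
    have "(x, ?a *\<^sub>R v, ?b *\<^sub>R \<zeta>) \<in> A" using False x by (simp add: A_def)
    from zmax[OF this] have "\<Phi> (x, ?a *\<^sub>R v, ?b *\<^sub>R \<zeta>) \<le> c" by (simp only: c_def)
    moreover have "\<Phi> (x, ?a *\<^sub>R v, ?b *\<^sub>R \<zeta>) = q x v \<zeta> / N x v \<zeta>"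
      using False scale[of ?b x ?a v \<zeta>] by (simp add: \<Phi>_def)
    ultimately show ?thesis using N_pos[of v \<zeta> x] False by (simp add: pos_divide_le_eq)
  qed
  have w0: "w \<noteq> 0" "\<zeta>\<^sub>0 \<noteq> 0" using pos hess_scale[of x\<^sub>0 0 w] by auto
  have eta_pos: "0 < \<eta> x \<longleftrightarrow> norm x < R" if "norm x \<le> R" for x
  proof -
    have "norm x < R \<longleftrightarrow> (norm x)\<^sup>2 < R\<^sup>2"
    proof (cases "norm x = R")
      case False
      then have "norm x < R" using that by simp
      then show ?thesis by (simp add: power_strict_mono)
    qed simp
    then show ?thesis by (simp add: \<eta>_def power2_norm_eq_inner)
  qed
  have "0 < q x\<^sub>0 w \<zeta>\<^sub>0" using pos eta_pos[of x\<^sub>0] x0 by (simp add: q_def)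
  then have "0 < c * N x\<^sub>0 w \<zeta>\<^sub>0" using bound[of x\<^sub>0 w \<zeta>\<^sub>0] x0 by linarith
  then have c: "0 < c" using N_pos[OF w0, of x\<^sub>0] by (simp add: zero_less_mult_iff)
  have cq: "q p v \<zeta> = c * N p v \<zeta>"
    using N_pos[OF v \<zeta>, of p] by (simp add: c_def z \<Phi>_def)
  define a where "a = 1 / sqrt (v \<bullet> (g p *v v))"
  define b where "b = 1 / sqrt (conormal_square p \<zeta>)"
  have gv: "0 < v \<bullet> (g p *v v)" and Kz: "0 < conormal_square p \<zeta>" by (rule g_pos[OF v], rule conormal_square_pos[OF \<zeta>])
  then have b: "0 < b" by (simp add: b_def)
  have n: "(a *\<^sub>R v) \<bullet> (g p *v (a *\<^sub>R v)) = 1" "conormal_square p (b *\<^sub>R \<zeta>) = 1"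
    unfolding g_scale conormal_square_scale using gv Kz by (simp_all add: a_def b_def power_divide)
  show ?thesis
  proof (rule that[of p c "a *\<^sub>R v" "b *\<^sub>R \<zeta>"])
    show "0 < c" by (rule c)
    show "(a *\<^sub>R v) \<bullet> (g p *v (a *\<^sub>R v)) = 1" "conormal_square p (b *\<^sub>R \<zeta>) = 1" by (rule n)+
    have "q p (a *\<^sub>R v) (b *\<^sub>R \<zeta>) = c * N p (a *\<^sub>R v) (b *\<^sub>R \<zeta>)" by (simp only: scale[OF b] cq) simp
    then show "\<eta> p * ((b *\<^sub>R \<zeta>) \<bullet> hess p (a *\<^sub>R v) (a *\<^sub>R v)) = c"
      unfolding q_def N_def n by simp
    show "\<eta> x * (\<zeta> \<bullet> hess x v v) \<le> c * ((v \<bullet> (g x *v v)) * sqrt (conormal_square x \<zeta>))" if "norm x \<le> R" for x v \<zeta>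
      using bound[OF that, of v \<zeta>] by (simp only: q_def N_def)
    show "norm p < R"
    proof (rule ccontr)
      assume "\<not> norm p < R"
      then have "norm p = R" using p by simp
      then have "\<eta> p = 0" by (simp add: \<eta>_def power2_norm_eq_inner[symmetric])
      then have "q p v \<zeta> = 0" by (simp add: q_def)
      then show False using cq c N_pos[OF v \<zeta>, of p] by simp
    qed
  qed
qed

text \<open>All terms of \<open>maximum_estimate\<close> are at most of order \<open>R\<^sup>3\<close>: the squared gradient is \<open>|p|\<^sup>2\<close> times
  the size \<open>C R\<close> of the inverse metric, and the cutoff, of size \<open>R\<^sup>2\<close>, meets a term of size \<open>R\<close>.\<close>

lemma weighted_hessian_bound:
  fixes R C :: real
  assumes C: "0 < C" and R: "1 \<le> R"
    and growth: "\<And>x v. norm x \<le> R \<Longrightarrow> (norm v)\<^sup>2 \<le> C * R * (v \<bullet> (g x *v v))"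
    and x0: "norm x\<^sub>0 < R" and pos: "0 < \<zeta>\<^sub>0 \<bullet> hess x\<^sub>0 w w"
  shows "((R\<^sup>2 - x\<^sub>0 \<bullet> x\<^sub>0) * (\<zeta>\<^sub>0 \<bullet> hess x\<^sub>0 w w))\<^sup>2
    \<le> (8 * C + 2 * (real CARD('m) * C + norm (fst T))) * R ^ 3 * ((w \<bullet> (g x\<^sub>0 *v w)) * sqrt (conormal_square x\<^sub>0 \<zeta>\<^sub>0))\<^sup>2"
proof -
  obtain p v \<zeta> c where p: "norm p < R" and c: "0 < c" and v: "v \<bullet> (g p *v v) = 1" and \<zeta>: "conormal_square p \<zeta> = 1"
    and att: "(R\<^sup>2 - p \<bullet> p) * (\<zeta> \<bullet> hess p v v) = c"
    and bound: "\<And>x v \<zeta>. norm x \<le> R \<Longrightarrow>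
      (R\<^sup>2 - x \<bullet> x) * (\<zeta> \<bullet> hess x v v) \<le> c * ((v \<bullet> (g x *v v)) * sqrt (conormal_square x \<zeta>))"
    using maximizer_exists[OF x0 pos] by metis
  obtain \<Lambda> :: "(real^'m) \<times> (real^'n) \<Rightarrow> (real^'m) \<times> (real^'n)"
    where \<Lambda>: "linear \<Lambda>" "bij \<Lambda>" "\<And>a b. pseudo_inner (\<Lambda> a) (\<Lambda> b) = pseudo_inner a b"
      "\<And>v. snd (\<Lambda> (v, du p v)) = 0"
    using boost_to_horizontal[OF linear_du du_contracts] by metis
  interpret boosted_soliton_graph u T \<Lambda> p
    by (intro boosted_soliton_graph.intro soliton_graph_axioms boosted_soliton_graph_axioms.intro)
      (simp_all add: \<Lambda> dX_def)
  have CR: "0 < C * R" using C R by simp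
  have lower: "1 / (C * R) * (norm v)\<^sup>2 \<le> v \<bullet> (g p *v v)" for v
    using growth[of p v] p CR by (simp add: pos_divide_le_eq mult.commute)
  have R2: "(norm p)\<^sup>2 \<le> R\<^sup>2" using p by (intro power_mono) auto
  have "p \<bullet> (g_inv p *v p) \<le> (norm p)\<^sup>2 * (C * R)"
    using inverse_matrix_bound(1)[OF g_pd _ lower, of p] CR by (simp add: g_inv_def)
  also have "\<dots> \<le> R\<^sup>2 * (C * R)" using R2 CR by (intro mult_right_mono) auto
  finally have 1: "p \<bullet> (g_inv p *v p) \<le> C * R ^ 3" by (simp add: power2_eq_square power3_eq_cube mult_ac)
  have "(\<Sum>k\<in>UNIV. g_inv p $ k $ k) \<le> (\<Sum>k\<in>(UNIV::'m set). C * R)"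
    using inverse_matrix_bound(2)[OF g_pd _ lower] CR by (intro sum_mono) (simp add: g_inv_def)
  then have tr: "(\<Sum>k\<in>UNIV. g_inv p $ k $ k) \<le> real CARD('m) * (C * R)" by simp
  have "fst T \<bullet> p \<le> norm (fst T) * norm p" by (rule norm_cauchy_schwarz)
  also have "\<dots> \<le> norm (fst T) * R" using p by (intro mult_left_mono) auto
  finally have "(\<Sum>k\<in>UNIV. g_inv p $ k $ k) + fst T \<bullet> p \<le> (real CARD('m) * C + norm (fst T)) * R"
    using tr by (simp add: algebra_simps)
  moreover have eta: "0 \<le> R\<^sup>2 - p \<bullet> p" "R\<^sup>2 - p \<bullet> p \<le> R\<^sup>2" using R2 by (auto simp: power2_norm_eq_inner)
  ultimately have "(R\<^sup>2 - p \<bullet> p) * ((\<Sum>k\<in>UNIV. g_inv p $ k $ k) + fst T \<bullet> p)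
      \<le> (R\<^sup>2 - p \<bullet> p) * ((real CARD('m) * C + norm (fst T)) * R)"
    by (intro mult_left_mono)
  also have "\<dots> \<le> R\<^sup>2 * ((real CARD('m) * C + norm (fst T)) * R)"
    using eta C R by (intro mult_right_mono) auto
  finally have 2: "(R\<^sup>2 - p \<bullet> p) * ((\<Sum>k\<in>UNIV. g_inv p $ k $ k) + fst T \<bullet> p)
      \<le> (real CARD('m) * C + norm (fst T)) * R ^ 3" by (simp add: power2_eq_square power3_eq_cube mult_ac)
  have "c\<^sup>2 \<le> 8 * (p \<bullet> (g_inv p *v p)) + 2 * (R\<^sup>2 - p \<bullet> p) * ((\<Sum>k\<in>UNIV. g_inv p $ k $ k) + fst T \<bullet> p)"
    by (rule maximum_estimate[OF p c v \<zeta> att bound])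
  also have "\<dots> \<le> (8 * C + 2 * (real CARD('m) * C + norm (fst T))) * R ^ 3"
    using 1 2 by (simp add: algebra_simps)
  finally have csq: "c\<^sup>2 \<le> (8 * C + 2 * (real CARD('m) * C + norm (fst T))) * R ^ 3" .
  have "(norm x\<^sub>0)\<^sup>2 \<le> R\<^sup>2" using x0 by (intro power_mono) auto
  then have "0 \<le> R\<^sup>2 - x\<^sub>0 \<bullet> x\<^sub>0" by (simp add: power2_norm_eq_inner)
  then have "((R\<^sup>2 - x\<^sub>0 \<bullet> x\<^sub>0) * (\<zeta>\<^sub>0 \<bullet> hess x\<^sub>0 w w))\<^sup>2 \<le> (c * ((w \<bullet> (g x\<^sub>0 *v w)) * sqrt (conormal_square x\<^sub>0 \<zeta>\<^sub>0)))\<^sup>2"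
    using bound[of x\<^sub>0 \<zeta>\<^sub>0 w] x0 pos by (intro power_mono) auto
  also have "\<dots> \<le> (8 * C + 2 * (real CARD('m) * C + norm (fst T))) * R ^ 3 * ((w \<bullet> (g x\<^sub>0 *v w)) * sqrt (conormal_square x\<^sub>0 \<zeta>\<^sub>0))\<^sup>2"
    unfolding power_mult_distrib[of c] by (rule mult_right_mono[OF csq]) simp
  finally show ?thesis .
qed

text \<open>In \<open>weighted_hessian_bound\<close> the left-hand side grows like \<open>R\<^sup>4\<close> and the right-hand side like
  \<open>R\<^sup>3\<close>.\<close>

lemma hessian_vanishes:
  fixes C :: real
  assumes C: "0 < C"
    and growth: "\<And>R x v. R\<^sub>1 \<le> R \<Longrightarrow> norm x \<le> R \<Longrightarrow> (norm v)\<^sup>2 \<le> C * R * (v \<bullet> (g x *v v))"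
  shows "hess x w w = 0"
proof (rule ccontr)
  assume ne: "hess x w w \<noteq> 0"
  define q where "q = hess x w w \<bullet> hess x w w"
  have q: "0 < q" using ne by (simp add: q_def)
  define M where "M = (8 * C + 2 * (real CARD('m) * C + norm (fst T))) * ((w \<bullet> (g x *v w)) * sqrt (conormal_square x (hess x w w)))\<^sup>2"
  \<comment> \<open>Large enough for \<open>|x| \<le> R / 2\<close>, so that the cutoff at \<open>x\<close> is at least \<open>R\<^sup>2 / 2\<close>, and for
    \<open>R\<^sup>4 q\<^sup>2 / 4 > M R\<^sup>3\<close>.\<close>
  define R where "R = Max {1, R\<^sub>1, 2 * norm x + 1, 4 * M / q\<^sup>2 + 1}"
  have R: "1 \<le> R" "R\<^sub>1 \<le> R" "2 * norm x + 1 \<le> R" "4 * M / q\<^sup>2 + 1 \<le> R"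
    by (auto simp: R_def)
  have x: "norm x < R" using R(3) norm_ge_zero[of x] by linarith
  have "((R\<^sup>2 - x \<bullet> x) * q)\<^sup>2 \<le> M * R ^ 3"
    using weighted_hessian_bound[OF C R(1) growth[OF R(2)] x, of "hess x w w" w] q
    by (simp add: M_def q_def mult_ac)
  moreover have "(R\<^sup>2 / 2 * q)\<^sup>2 \<le> ((R\<^sup>2 - x \<bullet> x) * q)\<^sup>2"
  proof -
    have "(2 * norm x)\<^sup>2 \<le> R\<^sup>2" using R(3) by (intro power_mono) auto
    then have "4 * (x \<bullet> x) \<le> R\<^sup>2" by (simp add: power_mult_distrib power2_norm_eq_inner)
    then have "R\<^sup>2 / 2 \<le> R\<^sup>2 - x \<bullet> x" using inner_ge_zero[of x] by linarith
    then show ?thesis using q by (intro power_mono mult_right_mono) auto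
  qed
  moreover have "(R\<^sup>2 / 2 * q)\<^sup>2 = R ^ 3 * (R * q\<^sup>2 / 4)"
    by (simp add: power2_eq_square power3_eq_cube)
  ultimately have "R ^ 3 * (R * q\<^sup>2 / 4) \<le> R ^ 3 * M" by (simp add: mult.commute)
  then have "R * q\<^sup>2 / 4 \<le> M" using R(1) by simp
  then have "R \<le> 4 * M / q\<^sup>2" using q by (simp add: pos_le_divide_eq)
  then show False using R(4) by linarith
qed

text \<open>Outside the ball of radius \<open>R\<^sub>0\<close> this is the hypothesis with \<open>|x| \<le> R\<close>; inside, the metric is bounded
  below by compactness.\<close>

lemma metric_lower_bound:
  assumes e: "0 < \<epsilon>" and R0: "0 < R\<^sub>0"
    and lower: "\<And>x. R\<^sub>0 < norm x \<Longrightarrow> positive_definite (g x - (\<epsilon> / norm x) *\<^sub>R mat 1)"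
  obtains C where "0 < C"
    "\<And>R x v. 1 \<le> R \<Longrightarrow> norm x \<le> R \<Longrightarrow> (norm v)\<^sup>2 \<le> C * R * (v \<bullet> (g x *v v))"
proof -
  define A where "A = cball (0::real^'m) R\<^sub>0 \<times> sphere (0::real^'m) 1"
  have "continuous_on A (\<lambda>z. snd z \<bullet> (g (fst z) *v snd z))"
    unfolding inner_vec_def matrix_vector_mult_def vec_lambda_beta inner_real_def
    by (intro continuous_intros continuous_on_smooth_fst smooth_g)
  moreover have "compact A" unfolding A_def by (intro compact_Times compact_cball compact_sphere)
  moreover have "(0, axis undefined 1) \<in> A" using R0 by (simp add: A_def norm_axis_1)
  then have "A \<noteq> {}" by blast
  ultimately obtain z where z: "z \<in> A"
    and zmin: "\<And>y. y \<in> A \<Longrightarrow> snd z \<bullet> (g (fst z) *v snd z) \<le> snd y \<bullet> (g (fst y) *v snd y)"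
    using continuous_attains_inf[of A "\<lambda>z. snd z \<bullet> (g (fst z) *v snd z)"] by blast
  define \<mu> where "\<mu> = snd z \<bullet> (g (fst z) *v snd z)"
  have "snd z \<noteq> 0" using z by (auto simp: A_def)
  then have mu: "0 < \<mu>" unfolding \<mu>_def by (rule g_pos)
  have inside: "\<mu> * (norm v)\<^sup>2 \<le> v \<bullet> (g x *v v)" if "norm x \<le> R\<^sub>0" for x v
  proof (cases "v = 0")
    case False
    then have "(x, (1 / norm v) *\<^sub>R v) \<in> A" using that by (simp add: A_def)
    from zmin[OF this] have "\<mu> \<le> (1 / norm v)\<^sup>2 * (v \<bullet> (g x *v v))"
      by (simp only: \<mu>_def fst_conv snd_conv g_scale)
    then show ?thesis using False by (simp add: power_divide field_simps)
  qed simp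
  have outside: "\<epsilon> / norm x * (norm v)\<^sup>2 \<le> v \<bullet> (g x *v v)" if "R\<^sub>0 < norm x" for x v
  proof (cases "v = 0")
    case False
    then have "0 < v \<bullet> ((g x - (\<epsilon> / norm x) *\<^sub>R mat 1) *v v)"
      using lower[OF that] by (simp add: positive_definite_def)
    then show ?thesis
      by (simp add: matrix_vector_mult_diff_rdistrib scaleR_matrix_vector_assoc[symmetric]
          inner_diff_right power2_norm_eq_inner)
  qed simp
  define C where "C = 1 / \<mu> + 1 / \<epsilon>"
  show ?thesis
  proof (rule that[of C])
    show "0 < C" using mu e by (simp add: C_def add_pos_pos)
    fix R :: real and x v :: "real^'m"
    assume R: "1 \<le> R" "norm x \<le> R"
    have gn: "0 \<le> v \<bullet> (g x *v v)" by (rule g_nonneg)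
    show "(norm v)\<^sup>2 \<le> C * R * (v \<bullet> (g x *v v))"
    proof (cases "norm x \<le> R\<^sub>0")
      case True
      have "(norm v)\<^sup>2 \<le> 1 / \<mu> * (v \<bullet> (g x *v v))"
        using inside[OF True, of v] mu by (simp add: field_simps)
      also have "\<dots> \<le> C * R * (v \<bullet> (g x *v v))"
      proof (rule mult_right_mono[OF _ gn])
        have "1 / \<mu> * 1 \<le> C * R" using mu e R by (intro mult_mono) (auto simp: C_def)
        then show "1 / \<mu> \<le> C * R" by simp
      qed
      finally show ?thesis .
    next
      case False
      then have nx: "0 < norm x" using R0 by linarith
      have "(norm v)\<^sup>2 \<le> 1 / \<epsilon> * norm x * (v \<bullet> (g x *v v))"
        using outside[of x v] False e nx by (simp add: field_simps)
      also have "\<dots> \<le> C * R * (v \<bullet> (g x *v v))"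
        using mu e R by (intro mult_right_mono[OF _ gn] mult_mono) (auto simp: C_def)
      finally show ?thesis .
    qed
  qed
qed

end

theorem theorem5:
  fixes u :: "'n::finite \<Rightarrow> real^'m::finite \<Rightarrow> real" and \<epsilon> :: real
  assumes "\<And>\<alpha>. smooth (u \<alpha>)"
    and "spacelike_translating_soliton (graph_map u)"
    and "\<epsilon> > 0"
    and "\<exists>R\<^sub>0>0. \<forall>x. norm x > R\<^sub>0 \<longrightarrow>
           positive_definite (induced_metric (graph_map u) x - (\<epsilon> / norm x) *\<^sub>R mat 1)"
  shows "(\<forall>\<alpha>. \<exists>(a :: real^'m) c. \<forall>x. u \<alpha> x = a \<bullet> x + c) \<and>
         affine (range (graph_map u)) \<and> aff_dim (range (graph_map u)) = int CARD('m)"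
proof -
  obtain T where T: "spacelike (graph_map u)"
    "\<And>x. mean_curvature_vector (graph_map u) x = normal_proj (graph_map u) x T"
    using assms(2) by (auto simp: spacelike_translating_soliton_def)
  interpret soliton_graph u T
    by unfold_locales (use assms(1) T in auto)
  obtain R\<^sub>0 where R0: "0 < R\<^sub>0"
    and lower: "\<And>x. R\<^sub>0 < norm x \<Longrightarrow> positive_definite (g x - (\<epsilon> / norm x) *\<^sub>R mat 1)"
    using assms(4) by (auto simp: g_def)
  obtain C where C: "0 < C"
    and growth: "\<And>R x v. 1 \<le> R \<Longrightarrow> norm x \<le> R \<Longrightarrow> (norm v)\<^sup>2 \<le> C * R * (v \<bullet> (g x *v v))"
    using metric_lower_bound[OF assms(3) R0 lower] by blast
  have "hess x v v = 0" for x v by (rule hessian_vanishes[OF C growth])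
  then have "dird v (dird v (u \<alpha>)) x = 0" for \<alpha> x v by (simp add: hess_def vec_eq_iff)
  then have affine: "u \<alpha> x = (\<chi> k. dird (axis k 1) (u \<alpha>) 0) \<bullet> x + u \<alpha> 0" for \<alpha> x
    by (rule affine_if_second_derivatives_vanish[OF assms(1)])
  then have "\<exists>(a :: real^'m) c. \<forall>x. u \<alpha> x = a \<bullet> x + c" for \<alpha> by blast
  moreover have "affine (range (graph_map u))" "aff_dim (range (graph_map u)) = int CARD('m)"
    by (rule graph_of_affine_functions[where u = u], rule affine)+
  ultimately show ?thesis by blast
qed

end
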